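(* Let $X$ be a metrizable, separable, locally compact space, let $\mathcal F=\{f_1,\dots,f_m\}$ be an iterated function system on $X$ with compact dynamics and global attractor $\mathcal G_{\mathcal F}$, and let $x\in\mathcal G_{\mathcal F}$. Let $\mathcal B_x$ be the set of all bitrajectories through $x$ lying entirely in $\mathcal G_{\mathcal F}$. Then exactly one of the following three cases occurs. (1) (Orbitwise recurrent dynamics) $x$ is orbitwise chain-recurrent. Equivalently, there exists a chain node $N$ such that $\omega(b)\subset N$ for every $b\in\mathcal B_x$, and $\alpha(b_0)\subset N$ for some $b_0\in\mathcal B_x$. (2) (Mixed recurrent-gradient dynamics) $x$ is chain-recurrent but not orbitwise chain-recurrent. Equivalently, denoting by $N$ the chain node containing $x$, there exist $b_{\mathrm r},b_{\mathrm g}\in\mathcal B_x$ and a chain node $P\ne N$ such that $\alpha(b_{\mathrm r})\cup\omega(b_{\mathrm r})\subset N$, whereas $\alpha(b_{\mathrm g})\subset N$ and $\omega(b_{\mathrm g})\subset P$. (3) (Gradient dynamics) $x$ is not chain-recurrent. Equivalently, for every $b\in\mathcal B_x$, the sets $\alpha(b)$ and $\omega(b)$ are contained in distinct chain nodes. In particular, every such bitrajectory determines an edge $N_{\alpha(b)}\to N_{\omega(b)}$ of the chain graph between distinct nodes, where $N_{\alpha(b)}\supset\alpha(b)$ and $N_{\omega(b)}\supset\omega(b)$ are the corresponding chain nodes.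
   Context: Fix any metric $d$ on $X$ compatible with its topology. An iterated function system (IFS) on $X$ is a finite collection $\mathcal F=\{f_1,\dots,f_m\}$, $m\ge1$, of continuous maps $X\to X$. $\mathcal I^m$ is the set of all finite words in the letters $1,\dots,m$ (including the empty word $0$); $|I|$ is the length of $I$. For $I=i_1\cdots i_k$, $\Phi^I_{\mathcal F}=f_{i_k}\circ\dots\circ f_{i_1}$, and $\Phi^0_{\mathcal F}=\mathrm{id}_X$. $H_{\mathcal F}(A)=\bigcup_{i=1}^m f_i(A)$; $A$ is $H$-invariant if $H_{\mathcal F}(A)=A$. The orbit of $x$ is $\mathcal O_{\mathcal F}(x)=\{\Phi^I_{\mathcal F}(x): I\in\mathcal I^m\}$. $N_\varepsilon(A)=\{x:d(x,A)<\varepsilon\}$. $A$ attracts $K$ if for every $\varepsilon>0$ there is $\tau>0$ with $\Phi^I_{\mathcal F}(K)\subset N_\varepsilon(A)$ for every $|I|\ge\tau$. A global attractor is a compact $H$-invariant set that attracts every compact subset of $X$; it is unique if it exists and is denoted $\mathcal G_{\mathcal F}$. $\mathcal F$ has compact dynamics if it has a global attractor. Chains: an $\varepsilon$-chain from $x$ to $y$ is a finite sequence $x_0=x,x_1,\dots,x_k=y$ ($k\ge0$) in $X$ with indices $i_0,\dots,i_{k-1}$ such that $d(f_{i_n}(x_n),x_{n+1})<\varepsilon$ for $n=0,\dots,k-1$. Write $x\succcurlyeq y$ if for every $\varepsilon>0$ there is an $\varepsilon$-chain from $x$ to $y$; $x,y$ are chain-equivalent if $x\succcurlyeq y$ and $y\succcurlyeq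 x$. A point $x$ is chain-recurrent if it is chain-equivalent to $f_i(x)$ for some $i$; it is orbitwise chain-recurrent if it is chain-equivalent to every point of $\mathcal O_{\mathcal F}(x)$. Chain nodes are the chain-equivalence classes of the set of chain-recurrent points. The chain graph has the chain nodes as vertices, with an edge from $N_1$ to $N_2\ne N_1$ when $x\succcurlyeq y$ for some $x\in N_1,y\in N_2$. A bitrajectory of $\mathcal F$ is a sequence $b=(b_n)_{n\in\mathbb Z}$ in $X$ together with indices $(i_n)_{n\in\mathbb Z}$ in $\{1,\dots,m\}$ such that $b_{n+1}=f_{i_n}(b_n)$ for all $n\in\mathbb Z$. It is through $x$ if $b_n=x$ for some $n$. $\omega(b)$ (resp. $\alpha(b)$) is the set of limits of sequences $b_{n_k}$ with $n_k\to+\infty$ (resp. $n_k\to-\infty$). *)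

theory Defs
  imports "HOL-Analysis.Analysis"
begin

text \<open>
  An iterated function system is given by its number \<open>m\<close> of maps and a family \<open>f\<close> of which only
  \<open>f 1, \<dots>, f m\<close> matter. The space is the whole type \<open>'a\<close>, and \<open>dist\<close> is an arbitrary metric
  inducing its topology.
\<close>

definition IFS :: "nat \<Rightarrow> (nat \<Rightarrow> 'a::metric_space \<Rightarrow> 'a) \<Rightarrow> bool" where
  "IFS m f \<longleftrightarrow> 1 \<le> m \<and> (\<forall>i\<in>{1..m}. continuous_on UNIV (f i))"

text \<open>
  Words are elements of \<open>lists {1..m}\<close>, and \<open>fold f [i\<^sub>1, \<dots>, i\<^sub>k] = f i\<^sub>k \<circ> \<dots> \<circ> f i\<^sub>1\<close>:
  the first letter acts first.
\<close>

definition hutchinson :: "nat \<Rightarrow> (nat \<Rightarrow> 'a \<Rightarrow> 'a) \<Rightarrow> 'a set \<Rightarrow> 'a set" where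
  "hutchinson m f A = (\<Union>i\<in>{1..m}. f i ` A)"

definition H_invariant :: "nat \<Rightarrow> (nat \<Rightarrow> 'a \<Rightarrow> 'a) \<Rightarrow> 'a set \<Rightarrow> bool" where
  "H_invariant m f A \<longleftrightarrow> hutchinson m f A = A"

definition orbit :: "nat \<Rightarrow> (nat \<Rightarrow> 'a \<Rightarrow> 'a) \<Rightarrow> 'a \<Rightarrow> 'a set" where
  "orbit m f x = (\<lambda>I. fold f I x) ` lists {1..m}"

text \<open>
  The set of points at distance less than \<open>e\<close> from \<open>A\<close>, with the convention \<open>d(x, \<emptyset>) = \<infinity>\<close>.
  (With \<open>infdist x {} = 0\<close> the empty set would attract everything.)
\<close>

definition nbhd :: "real \<Rightarrow> 'a::metric_space set \<Rightarrow> 'a set" where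
  "nbhd e A = {x. \<exists>a\<in>A. dist x a < e}"

definition attracts :: "nat \<Rightarrow> (nat \<Rightarrow> 'a::metric_space \<Rightarrow> 'a) \<Rightarrow> 'a set \<Rightarrow> 'a set \<Rightarrow> bool" where
  "attracts m f A K \<longleftrightarrow>
     (\<forall>e>0. \<exists>\<tau>>0. \<forall>I\<in>lists {1..m}. length I \<ge> \<tau> \<longrightarrow> fold f I ` K \<subseteq> nbhd e A)"

definition global_attractor :: "nat \<Rightarrow> (nat \<Rightarrow> 'a::metric_space \<Rightarrow> 'a) \<Rightarrow> 'a set \<Rightarrow> bool" where
  "global_attractor m f G \<longleftrightarrow>
     compact G \<and> H_invariant m f G \<and> (\<forall>K. compact K \<longrightarrow> attracts m f G K)"

definition eps_chain ::
  "nat \<Rightarrow> (nat \<Rightarrow> 'a::metric_space \<Rightarrow> 'a) \<Rightarrow> real \<Rightarrow> 'a \<Rightarrow> 'a \<Rightarrow> bool" where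
  "eps_chain m f e x y \<longleftrightarrow>
     (\<exists>(k::nat) (c::nat \<Rightarrow> 'a) (i::nat \<Rightarrow> nat). c 0 = x \<and> c k = y \<and>
        (\<forall>n<k. i n \<in> {1..m} \<and> dist (f (i n) (c n)) (c (Suc n)) < e))"

definition chain_ge :: "nat \<Rightarrow> (nat \<Rightarrow> 'a::metric_space \<Rightarrow> 'a) \<Rightarrow> 'a \<Rightarrow> 'a \<Rightarrow> bool" where
  "chain_ge m f x y \<longleftrightarrow> (\<forall>e>0. eps_chain m f e x y)"

definition chain_equivalent :: "nat \<Rightarrow> (nat \<Rightarrow> 'a::metric_space \<Rightarrow> 'a) \<Rightarrow> 'a \<Rightarrow> 'a \<Rightarrow> bool" where
  "chain_equivalent m f x y \<longleftrightarrow> chain_ge m f x y \<and> chain_ge m f y x"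

definition chain_recurrent :: "nat \<Rightarrow> (nat \<Rightarrow> 'a::metric_space \<Rightarrow> 'a) \<Rightarrow> 'a \<Rightarrow> bool" where
  "chain_recurrent m f x \<longleftrightarrow> (\<exists>i\<in>{1..m}. chain_equivalent m f x (f i x))"

definition orbitwise_chain_recurrent ::
  "nat \<Rightarrow> (nat \<Rightarrow> 'a::metric_space \<Rightarrow> 'a) \<Rightarrow> 'a \<Rightarrow> bool" where
  "orbitwise_chain_recurrent m f x \<longleftrightarrow> (\<forall>y\<in>orbit m f x. chain_equivalent m f x y)"

definition chain_nodes :: "nat \<Rightarrow> (nat \<Rightarrow> 'a::metric_space \<Rightarrow> 'a) \<Rightarrow> 'a set set" where
  "chain_nodes m f =
     {x. chain_recurrent m f x} //
     {(x, y). chain_recurrent m f x \<and> chain_recurrent m f y \<and> chain_equivalent m f x y}"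

definition chain_graph_edges ::
  "nat \<Rightarrow> (nat \<Rightarrow> 'a::metric_space \<Rightarrow> 'a) \<Rightarrow> ('a set \<times> 'a set) set" where
  "chain_graph_edges m f =
     {(N1, N2). N1 \<in> chain_nodes m f \<and> N2 \<in> chain_nodes m f \<and> N2 \<noteq> N1 \<and>
                (\<exists>x\<in>N1. \<exists>y\<in>N2. chain_ge m f x y)}"

definition bitrajectory ::
  "nat \<Rightarrow> (nat \<Rightarrow> 'a \<Rightarrow> 'a) \<Rightarrow> (int \<Rightarrow> 'a) \<times> (int \<Rightarrow> nat) \<Rightarrow> bool" where
  "bitrajectory m f = (\<lambda>(b, i). \<forall>n. i n \<in> {1..m} \<and> b (n + 1) = f (i n) (b n))"

definition omega_limit :: "(int \<Rightarrow> 'a::topological_space) \<times> (int \<Rightarrow> nat) \<Rightarrow> 'a set" where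
  "omega_limit = (\<lambda>(b, i).
     {y. \<exists>n::nat \<Rightarrow> int. filterlim n at_top sequentially \<and> (\<lambda>k. b (n k)) \<longlonglongrightarrow> y})"

definition alpha_limit :: "(int \<Rightarrow> 'a::topological_space) \<times> (int \<Rightarrow> nat) \<Rightarrow> 'a set" where
  "alpha_limit = (\<lambda>(b, i).
     {y. \<exists>n::nat \<Rightarrow> int. filterlim n at_bot sequentially \<and> (\<lambda>k. b (n k)) \<longlonglongrightarrow> y})"

definition bitrajectories_through ::
  "nat \<Rightarrow> (nat \<Rightarrow> 'a \<Rightarrow> 'a) \<Rightarrow> 'a set \<Rightarrow> 'a \<Rightarrow> ((int \<Rightarrow> 'a) \<times> (int \<Rightarrow> nat)) set" where
  "bitrajectories_through m f G x =
     {(b, i). bitrajectory m f (b, i) \<and> (\<exists>n. b n = x) \<and> range b \<subseteq> G}"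

lemma fold_image_invariant:
  assumes "H_invariant m f A" "a \<in> A"
  shows "\<exists>I\<in>lists {1..m}. length I = n \<and> a \<in> fold f I ` A"
  using assms(2)
proof (induction n arbitrary: a)
  case 0
  then show ?case by auto
next
  case (Suc n)
  then obtain i b where i: "i \<in> {1..m}" "b \<in> A" "a = f i b"
    using assms(1) unfolding H_invariant_def hutchinson_def by blast
  obtain I where I: "I \<in> lists {1..m}" "length I = n" "b \<in> fold f I ` A"
    using Suc.IH[OF i(2)] by blast
  obtain c where c: "c \<in> A" "b = fold f I c"
    using I(3) by (rule imageE)
  have "fold f (I @ [i]) c = a"
    using c(2) i(3) by simp
  then have "a \<in> fold f (I @ [i]) ` A"
    using c(1) by (metis imageI)
  moreover have "I @ [i] \<in> lists {1..m}" "length (I @ [i]) = Suc n"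
    using i(1) I(1,2) by simp_all
  ultimately show ?case by metis
qed

text \<open>A global attractor, if it exists, is unique.\<close>

lemma global_attractor_unique:
  assumes "global_attractor m f G" "global_attractor m f G'"
  shows "G = G'"
proof -
  have sub: "A \<subseteq> B" if A: "global_attractor m f A" and B: "global_attractor m f B" for A B
  proof
    fix a assume a: "a \<in> A"
    have inv: "H_invariant m f A" and cpt: "compact A" "compact B"
      using A B by (simp_all add: global_attractor_def)
    have att: "attracts m f B A"
      using B cpt(1) by (simp add: global_attractor_def)
    have "\<exists>y\<in>B. dist y a < e" if "0 < e" for e :: real
    proof -
      obtain t :: nat
        where t: "\<forall>I\<in>lists {1..m}. length I \<ge> t \<longrightarrow> fold f I ` A \<subseteq> nbhd e B"
        using att[unfolded attracts_def, rule_format, OF \<open>0 < e\<close>] by (elim exE conjE)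
      obtain I where I: "I \<in> lists {1..m}" "length I = t" "a \<in> fold f I ` A"
        using fold_image_invariant[OF inv a, of t] by (elim bexE conjE)
      have "fold f I ` A \<subseteq> nbhd e B"
        using t I(1,2) by simp
      then have "a \<in> nbhd e B"
        using I(3) by (rule subsetD)
      then show ?thesis
        by (simp add: nbhd_def dist_commute)
    qed
    then have "a \<in> closure B"
      by (simp add: closure_approachable)
    then show "a \<in> B"
      using compact_imp_closed[OF cpt(2)] by simp
  qed
  show ?thesis
    using sub[OF assms] sub[OF assms(2,1)] by (rule subset_antisym)
qed

end

theory Submission
  imports Defs
begin

text \<open>
  All limit points of the past (future) of a bitrajectory in the compact set \<open>G\<close> are
  chain-recurrent and chain-equivalent, so each limit set lies in one node, and
  \<open>w \<succcurlyeq> x \<succcurlyeq> z\<close> for \<open>w\<close> in the \<open>\<alpha>\<close>-limit set and \<open>z\<close> in the \<open>\<omega>\<close>-limit set. If both limit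
  sets lie in the same node, \<open>x\<close> is therefore chain-recurrent. Conversely a chain-recurrent point of
  \<open>G\<close> has an image and a preimage in \<open>G\<close> in its own node, hence a bitrajectory inside its node; the
  preimage is a limit of the penultimate points of \<open>\<epsilon>\<close>-chains from \<open>x\<close> to itself, which stay near \<open>G\<close>
  because \<open>G\<close> has arbitrarily small compact neighbourhoods mapped into their own interior. The past of
  such a bitrajectory can be spliced with any forward trajectory of \<open>x\<close>; one through an orbit point
  not chain-equivalent to \<open>x\<close> can never return to the node of \<open>x\<close>.
\<close>

subsection \<open>Chains\<close>

text \<open>If each index failed at a threshold of its own, all would fail at the least of these
  finitely many thresholds. The swap of quantifiers yields one letter for all \<open>e\<close>, as
  chain-recurrence demands.\<close>

lemma finite_uniform_choice:
  fixes P :: "'i \<Rightarrow> real \<Rightarrow> bool"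
  assumes "finite A"
    and mono: "\<And>i d e. P i d \<Longrightarrow> d \<le> e \<Longrightarrow> P i e"
    and ex: "\<And>e. e > 0 \<Longrightarrow> \<exists>i\<in>A. P i e"
  shows "\<exists>i\<in>A. \<forall>e>0. P i e"
proof (rule ccontr)
  assume "\<not> ?thesis"
  then have "\<forall>i\<in>A. \<exists>e>0. \<not> P i e" by blast
  then obtain e where e: "\<forall>i\<in>A. e i > 0 \<and> \<not> P i (e i)" by metis
  have "A \<noteq> {}" using ex[of 1] by auto
  define d where "d = Min (e ` A)"
  have "d > 0" using e \<open>A \<noteq> {}\<close> \<open>finite A\<close> by (simp add: d_def)
  then obtain i where "i \<in> A" "P i d" using ex by blast
  moreover have "d \<le> e i" using \<open>i \<in> A\<close> \<open>finite A\<close> by (simp add: d_def)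
  ultimately show False using e mono by blast
qed

text \<open>Chains are the paths of this relation, so splitting off a first or last jump and
  induction along a chain become rules for closures of relations. The transitive closure describes
  chains with at least one jump.\<close>

definition eps_step ::
  "nat \<Rightarrow> (nat \<Rightarrow> 'a::metric_space \<Rightarrow> 'a) \<Rightarrow> real \<Rightarrow> 'a \<Rightarrow> 'a \<Rightarrow> bool" where
  "eps_step m f e u v \<longleftrightarrow> (\<exists>i\<in>{1..m}. dist (f i u) v < e)"

lemma eps_chain_iff_rtranclp: "eps_chain m f e = (eps_step m f e)\<^sup>*\<^sup>*"
proof (intro ext)
  fix x y
  have "eps_chain m f e x y \<longleftrightarrow> (\<exists>k c. c 0 = x \<and> c k = y \<and> (\<forall>n<k. eps_step m f e (c n) (c (Suc n))))"
    unfolding eps_chain_def eps_step_def by metis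
  also have "\<dots> \<longleftrightarrow> (eps_step m f e)\<^sup>*\<^sup>* x y"
    by (simp add: rtranclp_power relpowp_fun_conv)
  finally show "eps_chain m f e x y = (eps_step m f e)\<^sup>*\<^sup>* x y" .
qed

lemma eps_step_mono: "eps_step m f d u v \<Longrightarrow> d \<le> e \<Longrightarrow> eps_step m f e u v"
  unfolding eps_step_def by force

lemma eps_chain_mono: "eps_chain m f d x y \<Longrightarrow> d \<le> e \<Longrightarrow> eps_chain m f e x y"
  unfolding eps_chain_iff_rtranclp by (metis eps_step_mono mono_rtranclp)

lemma eps_chain_trans: "eps_chain m f e x y \<Longrightarrow> eps_chain m f e y z \<Longrightarrow> eps_chain m f e x z"
  unfolding eps_chain_iff_rtranclp by (rule rtranclp_trans)

lemma eps_chain_step: "i \<in> {1..m} \<Longrightarrow> dist (f i x) y < e \<Longrightarrow> eps_chain m f e x y"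
  unfolding eps_chain_iff_rtranclp eps_step_def by blast

lemma eps_step_tranclp_mono: "(eps_step m f d)\<^sup>+\<^sup>+ x y \<Longrightarrow> d \<le> e \<Longrightarrow> (eps_step m f e)\<^sup>+\<^sup>+ x y"
  by (induction rule: tranclp_induct) (auto intro: eps_step_mono tranclp.intros)

lemma chain_ge_refl [simp]: "chain_ge m f x x"
  by (simp add: chain_ge_def eps_chain_iff_rtranclp)

lemma chain_ge_trans: "chain_ge m f x y \<Longrightarrow> chain_ge m f y z \<Longrightarrow> chain_ge m f x z"
  unfolding chain_ge_def using eps_chain_trans by metis

lemma eps_chain_chain_ge_trans:
  "eps_chain m f e x y \<Longrightarrow> chain_ge m f y z \<Longrightarrow> e > 0 \<Longrightarrow> eps_chain m f e x z"
  unfolding chain_ge_def using eps_chain_trans by blast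

lemma chain_ge_eps_chain_trans:
  "chain_ge m f x y \<Longrightarrow> eps_chain m f e y z \<Longrightarrow> e > 0 \<Longrightarrow> eps_chain m f e x z"
  unfolding chain_ge_def using eps_chain_trans by blast

lemma chain_ge_map: "i \<in> {1..m} \<Longrightarrow> chain_ge m f x (f i x)"
  unfolding chain_ge_def by (simp add: eps_chain_step)

text \<open>The last jump of a chain to a nearby \<open>y'\<close> can be redirected to
  \<open>y\<close>, at the cost of the distance between them.\<close>

lemma chain_ge_closed:
  assumes "\<And>e. e > 0 \<Longrightarrow> \<exists>y'. dist y' y < e \<and> eps_chain m f e x y'"
  shows "chain_ge m f x y"
proof (cases "x = y")
  case False
  show ?thesis unfolding chain_ge_def
  proof (intro allI impI)
    fix e :: real assume "e > 0"
    \<comment> \<open>The bound \<open>dist x y\<close> excludes \<open>y' = x\<close>, so the chain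
      has a last jump to redirect; \<open>e/2\<close> leaves room for redirecting it.\<close>
    then have "min (e/2) (dist x y) > 0" using False by simp
    then obtain y' where y': "dist y' y < min (e/2) (dist x y)"
        "eps_chain m f (min (e/2) (dist x y)) x y'" using assms by blast
    then have "x \<noteq> y'" by auto
    then obtain z where z: "(eps_step m f (min (e/2) (dist x y)))\<^sup>*\<^sup>* x z"
        "eps_step m f (min (e/2) (dist x y)) z y'"
      using y'(2) unfolding eps_chain_iff_rtranclp by (metis rtranclp.cases)
    then obtain i where i: "i \<in> {1..m}" "dist (f i z) y' < e/2" unfolding eps_step_def by auto
    have "dist (f i z) y < e" using i(2) y'(1) dist_triangle[of "f i z" y y'] by linarith
    then have "eps_chain m f e z y" using i(1) by (simp add: eps_chain_step)
    moreover have "eps_chain m f e x z"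
      using z(1) eps_chain_mono[of m f _ x z e] \<open>e > 0\<close> by (simp add: eps_chain_iff_rtranclp min_le_iff_disj)
    ultimately show "eps_chain m f e x y" by (rule eps_chain_trans[rotated])
  qed
qed simp

lemma chain_equivalent_refl [simp]: "chain_equivalent m f x x"
  by (simp add: chain_equivalent_def)

lemma chain_equivalent_sym: "chain_equivalent m f x y \<Longrightarrow> chain_equivalent m f y x"
  by (simp add: chain_equivalent_def)

lemma chain_equivalent_trans:
  "chain_equivalent m f x y \<Longrightarrow> chain_equivalent m f y z \<Longrightarrow> chain_equivalent m f x z"
  unfolding chain_equivalent_def by (metis chain_ge_trans)

text \<open>Since \<open>x\<close> always reaches \<open>f i x\<close>, only the return from
  \<open>f i x\<close> matters.\<close>

lemma chain_recurrent_iff: "chain_recurrent m f x \<longleftrightarrow> (\<exists>i\<in>{1..m}. chain_ge m f (f i x) x)"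
  unfolding chain_recurrent_def chain_equivalent_def by (metis chain_ge_map)

lemma chain_recurrentI:
  assumes "\<And>e. e > 0 \<Longrightarrow> \<exists>i\<in>{1..m}. eps_chain m f e (f i x) x"
  shows "chain_recurrent m f x"
  unfolding chain_recurrent_iff chain_ge_def
  using assms by (intro finite_uniform_choice) (auto intro: eps_chain_mono)

subsection \<open>Chain nodes\<close>

lemma chain_nodes_iff:
  "N \<in> chain_nodes m f \<longleftrightarrow>
    (\<exists>a. chain_recurrent m f a \<and> N = {y. chain_recurrent m f y \<and> chain_equivalent m f a y})"
  unfolding chain_nodes_def quotient_def by auto

lemma chain_node_recurrent: "N \<in> chain_nodes m f \<Longrightarrow> a \<in> N \<Longrightarrow> chain_recurrent m f a"
  unfolding chain_nodes_iff by auto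

lemma chain_node_equivalent:
  "N \<in> chain_nodes m f \<Longrightarrow> a \<in> N \<Longrightarrow> b \<in> N \<Longrightarrow> chain_equivalent m f a b"
  unfolding chain_nodes_iff by (auto intro: chain_equivalent_trans chain_equivalent_sym)

lemma chain_node_memI:
  "N \<in> chain_nodes m f \<Longrightarrow> a \<in> N \<Longrightarrow> chain_equivalent m f a b \<Longrightarrow> chain_recurrent m f b \<Longrightarrow> b \<in> N"
  unfolding chain_nodes_iff by (auto intro: chain_equivalent_trans)

lemma chain_nodes_disjoint:
  "N \<in> chain_nodes m f \<Longrightarrow> P \<in> chain_nodes m f \<Longrightarrow> a \<in> N \<Longrightarrow> a \<in> P \<Longrightarrow> N = P"
  by (meson chain_node_equivalent chain_node_memI chain_node_recurrent equalityI subsetI)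

lemma ex_chain_node_superset:
  assumes "S \<noteq> {}" "\<And>y. y \<in> S \<Longrightarrow> chain_recurrent m f y"
    and "\<And>y z. y \<in> S \<Longrightarrow> z \<in> S \<Longrightarrow> chain_ge m f y z"
  shows "\<exists>N\<in>chain_nodes m f. S \<subseteq> N"
proof -
  obtain a where "a \<in> S" using assms(1) by blast
  then have "{y. chain_recurrent m f y \<and> chain_equivalent m f a y} \<in> chain_nodes m f"
    using assms(2) by (auto simp: chain_nodes_iff)
  moreover have "S \<subseteq> {y. chain_recurrent m f y \<and> chain_equivalent m f a y}"
    using \<open>a \<in> S\<close> assms(2,3) by (auto simp: chain_equivalent_def)
  ultimately show ?thesis by blast
qed

subsection \<open>Bitrajectories and their limit sets\<close>

lemma bitrajectory_chain_ge:
  assumes "bitrajectory m f (b, i)" "p \<le> q"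
  shows "chain_ge m f (b p) (b q)"
  using assms(2)
proof (induction q rule: int_ge_induct)
  case (step q)
  then show ?case using assms(1) chain_ge_map[of "i q" m f "b q"] chain_ge_trans
    by (fastforce simp: bitrajectory_def)
qed simp

lemma omega_limitD:
  assumes "y \<in> omega_limit (b, i)" "e > 0"
  shows "\<exists>n\<ge>p. dist y (b n) < e"
proof -
  obtain n :: "nat \<Rightarrow> int" where n: "filterlim n at_top sequentially" "(\<lambda>k. b (n k)) \<longlonglongrightarrow> y"
    using assms(1) by (auto simp: omega_limit_def)
  have "\<forall>\<^sub>F k in sequentially. n k \<ge> p" using n(1) by (simp add: filterlim_at_top)
  moreover have "\<forall>\<^sub>F k in sequentially. dist (b (n k)) y < e" using n(2) assms(2) by (rule tendstoD)
  ultimately have "\<forall>\<^sub>F k in sequentially. n k \<ge> p \<and> dist (b (n k)) y < e"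
    by (rule eventually_conj)
  then obtain k where "n k \<ge> p \<and> dist (b (n k)) y < e"
    using eventually_happens'[OF sequentially_bot] by blast
  then show ?thesis by (auto simp: dist_commute)
qed

lemma alpha_limitD:
  assumes "y \<in> alpha_limit (b, i)" "e > 0"
  shows "\<exists>n\<le>p. dist y (b n) < e"
proof -
  obtain n :: "nat \<Rightarrow> int" where n: "filterlim n at_bot sequentially" "(\<lambda>k. b (n k)) \<longlonglongrightarrow> y"
    using assms(1) by (auto simp: alpha_limit_def)
  have "\<forall>\<^sub>F k in sequentially. n k \<le> p" using n(1) by (simp add: filterlim_at_bot)
  moreover have "\<forall>\<^sub>F k in sequentially. dist (b (n k)) y < e" using n(2) assms(2) by (rule tendstoD)
  ultimately have "\<forall>\<^sub>F k in sequentially. n k \<le> p \<and> dist (b (n k)) y < e"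
    by (rule eventually_conj)
  then obtain k where "n k \<le> p \<and> dist (b (n k)) y < e"
    using eventually_happens'[OF sequentially_bot] by blast
  then show ?thesis by (auto simp: dist_commute)
qed

lemma omega_limit_nonempty:
  fixes b :: "int \<Rightarrow> 'a::metric_space"
  assumes "compact G" "range b \<subseteq> G"
  shows "omega_limit (b, i) \<noteq> {}"
proof -
  have "\<forall>n. (\<lambda>k. b (int k)) n \<in> G" using assms(2) by blast
  then obtain l r where r: "strict_mono r" "((\<lambda>k. b (int k)) \<circ> r) \<longlonglongrightarrow> l"
    using assms(1) by (meson compact_eq_seq_compact_metric seq_compactE)
  have "filterlim (\<lambda>k. int (r k)) at_top sequentially"
    using filterlim_compose[OF filterlim_int_sequentially filterlim_subseq[OF r(1)]] .
  then show ?thesis using r(2) by (auto simp: omega_limit_def o_def)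
qed

lemma alpha_limit_nonempty:
  fixes b :: "int \<Rightarrow> 'a::metric_space"
  assumes "compact G" "range b \<subseteq> G"
  shows "alpha_limit (b, i) \<noteq> {}"
proof -
  have "\<forall>n. (\<lambda>k. b (- int k)) n \<in> G" using assms(2) by blast
  then obtain l r where r: "strict_mono r" "((\<lambda>k. b (- int k)) \<circ> r) \<longlonglongrightarrow> l"
    using assms(1) by (meson compact_eq_seq_compact_metric seq_compactE)
  have "filterlim (\<lambda>k. int (r k)) at_top sequentially"
    using filterlim_compose[OF filterlim_int_sequentially filterlim_subseq[OF r(1)]] .
  then have "filterlim (\<lambda>k. - int (r k)) at_bot sequentially"
    unfolding filterlim_at_bot filterlim_at_top
  proof (intro allI)
    fix Z :: int
    assume "\<forall>Z. \<forall>\<^sub>F k in sequentially. Z \<le> int (r k)"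
    then have "\<forall>\<^sub>F k in sequentially. - Z \<le> int (r k)" by blast
    then show "\<forall>\<^sub>F k in sequentially. - int (r k) \<le> Z" by eventually_elim simp
  qed
  then show ?thesis using r(2) by (auto simp: alpha_limit_def o_def)
qed

text \<open>Closeness of \<open>b n\<close> to \<open>y\<close> alone gives no chain out of
  \<open>b n\<close>, since every jump follows a map; instead the exact step into \<open>b n\<close>
  is bent towards \<open>y\<close>.\<close>

lemma bitrajectory_eps_chain_to_limit:
  assumes "bitrajectory m f (b, i)" "dist y (b n) < e"
  shows "eps_chain m f e (b (n - 1)) y"
proof -
  have "i (n-1) \<in> {1..m}" "b n = f (i (n-1)) (b (n-1))"
    using assms(1) unfolding bitrajectory_def by (auto dest: spec[of _ "n-1"])
  then show ?thesis using assms(2) eps_chain_step[of "i (n-1)" m f "b (n-1)" y e]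
    by (simp add: dist_commute)
qed

lemma chain_ge_omega:
  assumes "bitrajectory m f (b, i)" "y \<in> omega_limit (b, i)"
  shows "chain_ge m f (b p) y"
  unfolding chain_ge_def
proof (intro allI impI)
  fix e :: real assume "e > 0"
  \<comment> \<open>Late enough that the penultimate time \<open>n - 1\<close> is still at least
    \<open>p\<close>.\<close>
  obtain n where n: "n \<ge> p + 1" "dist y (b n) < e"
    using omega_limitD[OF assms(2) \<open>e > 0\<close>] by blast
  have "chain_ge m f (b p) (b (n - 1))"
    using n(1) by (intro bitrajectory_chain_ge[OF assms(1)]) simp
  then show "eps_chain m f e (b p) y"
    using bitrajectory_eps_chain_to_limit[OF assms(1) n(2)] \<open>e > 0\<close> by (rule chain_ge_eps_chain_trans)
qed

lemma bitrajectory_step: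
  "bitrajectory m f (b, i) \<Longrightarrow> i n \<in> {1..m} \<and> b (n + 1) = f (i n) (b n)"
  by (simp add: bitrajectory_def)

text \<open>The two halves of a bitrajectory through \<open>x\<close> can be chosen independently.\<close>

lemma splice_bitrajectory:
  fixes u v :: "nat \<Rightarrow> 'a::metric_space"
  assumes u: "u 0 = x" "\<And>n. \<exists>i\<in>{1..m}. u n = f i (u (Suc n))"
    and v: "v 0 = x" "\<And>n. \<exists>i\<in>{1..m}. v (Suc n) = f i (v n)"
    and "range u \<subseteq> G" "range v \<subseteq> G"
  obtains b i where "(b, i) \<in> bitrajectories_through m f G x"
    "\<And>n. b (int n) = v n" "\<And>n. b (- int n) = u n"
proof -
  define b where "b n = (if n \<ge> 0 then v (nat n) else u (nat (- n)))" for n :: int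
  have v': "b (int n) = v n" for n by (simp add: b_def)
  have u': "b (- int n) = u n" for n using u(1) v(1) by (simp add: b_def)
  have "\<exists>i\<in>{1..m}. b (n + 1) = f i (b n)" for n :: int
  proof (cases "n \<ge> 0")
    case True
    then obtain k where "n = int k" by (metis nonneg_int_cases)
    then show ?thesis using v(2)[of k] v'[of k] v'[of "Suc k"] by (simp add: add.commute)
  next
    case False
    then obtain k where "n = - int (Suc k)"
      by (metis neg_int_cases not_le Suc_diff_1 minus_minus)
    then show ?thesis using u(2)[of k] u'[of k] u'[of "Suc k"] by simp
  qed
  then obtain i where i: "\<And>n. i n \<in> {1..m} \<and> b (n + 1) = f (i n) (b n)" by metis
  have "range b \<subseteq> G" using assms(5,6) by (auto simp: b_def)
  moreover have "b 0 = x" using v' v(1) by (metis of_nat_0)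
  ultimately have "(b, i) \<in> bitrajectories_through m f G x"
    using i by (auto simp: bitrajectories_through_def bitrajectory_def)
  then show ?thesis using that u' v' by blast
qed

subsection \<open>Consequences of continuity\<close>

locale cts_ifs =
  fixes m :: nat and f :: "nat \<Rightarrow> 'a::metric_space \<Rightarrow> 'a"
  assumes ifs: "IFS m f"
begin

lemma one_le_m: "1 \<le> m"
  using ifs by (simp add: IFS_def)

lemma continuous_map: "i \<in> {1..m} \<Longrightarrow> continuous_on A (f i)"
  using ifs continuous_on_subset unfolding IFS_def by blast

lemma continuous_word: "I \<in> lists {1..m} \<Longrightarrow> continuous_on A (fold f I)"
proof (induction I arbitrary: A)
  case (Cons i I)
  have "continuous_on A (fold f I \<circ> f i)"
    using Cons by (intro continuous_on_compose continuous_map) auto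
  then show ?case by simp
qed (simp add: id_def)

lemma maps_equicontinuous_at:
  assumes "e > 0"
  obtains d where "d > 0" "\<And>i y. i \<in> {1..m} \<Longrightarrow> dist x y < d \<Longrightarrow> dist (f i x) (f i y) < e"
proof -
  have "\<exists>d>0. \<forall>y. dist x y < d \<longrightarrow> dist (f i x) (f i y) < e" if "i \<in> {1..m}" for i
    using continuous_map[OF that, of UNIV] assms unfolding continuous_on_iff
    by (metis UNIV_I dist_commute)
  then obtain d where d: "\<And>i. i \<in> {1..m} \<Longrightarrow>
      d i > 0 \<and> (\<forall>y. dist x y < d i \<longrightarrow> dist (f i x) (f i y) < e)" by metis
  have "{1..m} \<noteq> {}" using one_le_m by simp
  then have "Min (d ` {1..m}) > 0" using d by simp
  moreover have "Min (d ` {1..m}) \<le> d i" if "i \<in> {1..m}" for i using that by simp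
  ultimately show ?thesis using that d by (metis order_less_le_trans)
qed

text \<open>The first jump of a chain with at least two steps can be absorbed into the second one.\<close>

lemma chain_recurrent_equivalent:
  assumes "chain_equivalent m f x y" "x \<noteq> y"
  shows "chain_recurrent m f y"
proof (rule chain_recurrentI)
  fix e :: real assume "e > 0"
  \<comment> \<open>The letter \<open>i\<close> must be fixed before the accuracy, because the
    latter will come from continuity at \<open>f i y\<close>.\<close>
  have "\<exists>i\<in>{1..m}. \<forall>d>0. \<exists>u. dist (f i y) u < d \<and> (eps_step m f d)\<^sup>+\<^sup>+ u y"
  proof (rule finite_uniform_choice)
    fix i :: nat and d d' :: real
    assume "\<exists>u. dist (f i y) u < d \<and> (eps_step m f d)\<^sup>+\<^sup>+ u y" "d \<le> d'"
    then show "\<exists>u. dist (f i y) u < d' \<and> (eps_step m f d')\<^sup>+\<^sup>+ u y"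
      by (meson eps_step_tranclp_mono order_less_le_trans)
  next
    fix d :: real assume "d > 0"
    then have yx: "(eps_step m f d)\<^sup>*\<^sup>* y x" and xy: "(eps_step m f d)\<^sup>*\<^sup>* x y"
      using assms(1) by (auto simp: chain_equivalent_def chain_ge_def eps_chain_iff_rtranclp)
    \<comment> \<open>\<open>x \<noteq> y\<close> makes both halves of the loop nonempty, so a jump
      remains after the first one.\<close>
    obtain u where u: "eps_step m f d y u" "(eps_step m f d)\<^sup>*\<^sup>* u x"
      using yx assms(2) by (metis converse_rtranclpE)
    have "(eps_step m f d)\<^sup>+\<^sup>+ x y" using xy assms(2) by (metis rtranclpD)
    then have "(eps_step m f d)\<^sup>+\<^sup>+ u y" using u(2) by (rule rtranclp_tranclp_tranclp[rotated])
    then show "\<exists>i\<in>{1..m}. \<exists>u. dist (f i y) u < d \<and> (eps_step m f d)\<^sup>+\<^sup>+ u y"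
      using u(1) unfolding eps_step_def by blast
  qed simp
  then obtain i where i: "i \<in> {1..m}"
    "\<And>d. d > 0 \<Longrightarrow> \<exists>u. dist (f i y) u < d \<and> (eps_step m f d)\<^sup>+\<^sup>+ u y" by blast
  obtain d where d: "d > 0" "\<And>j z. j \<in> {1..m} \<Longrightarrow> dist (f i y) z < d \<Longrightarrow> dist (f j (f i y)) (f j z) < e/2"
    using maps_equicontinuous_at[of "e/2" "f i y"] \<open>e > 0\<close> by auto
  have "min d (e/2) > 0" using d(1) \<open>e > 0\<close> by simp
  then obtain u where u: "dist (f i y) u < min d (e/2)" "(eps_step m f (min d (e/2)))\<^sup>+\<^sup>+ u y"
    using i(2) by blast
  then obtain w where w: "eps_step m f (min d (e/2)) u w" "(eps_step m f (min d (e/2)))\<^sup>*\<^sup>* w y"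
    by (metis tranclpD)
  obtain j where j: "j \<in> {1..m}" "dist (f j u) w < e/2" using w(1) unfolding eps_step_def by auto
  have "dist (f j (f i y)) (f j u) < e/2" using d(2) j(1) u(1) by simp
  then have "dist (f j (f i y)) w < e"
    using j(2) dist_triangle[of "f j (f i y)" w "f j u"] by linarith
  then have "eps_chain m f e (f i y) w" using j(1) by (simp add: eps_chain_step)
  moreover have "eps_chain m f e w y"
    using w(2) eps_chain_mono[of m f "min d (e/2)" w y e] \<open>e > 0\<close>
    by (simp add: eps_chain_iff_rtranclp min_le_iff_disj)
  ultimately show "\<exists>i\<in>{1..m}. eps_chain m f e (f i y) y" using i(1) by (blast intro: eps_chain_trans[of m f e])
qed

lemma chain_recurrent_iff_equivalent:
  "chain_equivalent m f x y \<Longrightarrow> chain_recurrent m f x \<longleftrightarrow> chain_recurrent m f y"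
  by (metis chain_recurrent_equivalent chain_equivalent_sym)

section \<open>Limit sets lie in chain nodes\<close>

text \<open>A point near \<open>b n\<close> follows the next two letters of the bitrajectory: the
  first application is exact and produces \<open>f j y\<close>, the second supplies the jump to
  \<open>b (n + 2)\<close>. Continuity is used only at \<open>y\<close> and its images, so
  \<open>d\<close> does not depend on \<open>n\<close>.\<close>

lemma eps_chain_near_bitrajectory:
  assumes "bitrajectory m f (b, i)" "e > 0"
  obtains d where "d > 0" "\<And>n. dist y (b n) < d \<Longrightarrow> \<exists>j\<in>{1..m}. eps_chain m f e (f j y) (b (n + 2))"
proof -
  have "\<exists>d>0. \<forall>k\<in>{1..m}. \<forall>z. dist (f j y) z < d \<longrightarrow> dist (f k (f j y)) (f k z) < e" for j
    by (rule maps_equicontinuous_at[OF assms(2), of "f j y"]) blast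
  then obtain d where d: "\<And>j. d j > 0 \<and>
      (\<forall>k\<in>{1..m}. \<forall>z. dist (f j y) z < d j \<longrightarrow> dist (f k (f j y)) (f k z) < e)" by metis
  \<comment> \<open>A radius that serves at each of the finitely many images \<open>f j y\<close>,
    since \<open>j\<close> will be the letter at a time not yet known.\<close>
  define c where "c = Min (d ` {1..m})"
  have "{1..m} \<noteq> {}" using one_le_m by simp
  then have "c > 0" using d by (simp add: c_def)
  obtain d' where d': "d' > 0" "\<And>j z. j \<in> {1..m} \<Longrightarrow> dist y z < d' \<Longrightarrow> dist (f j y) (f j z) < c"
    by (rule maps_equicontinuous_at[OF \<open>c > 0\<close>, of y]) blast
  show ?thesis
  proof
    fix n assume n: "dist y (b n) < d'"
    have 1: "i n \<in> {1..m}" "b (n + 1) = f (i n) (b n)"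
      and 2: "i (n+1) \<in> {1..m}" "b (n + 2) = f (i (n+1)) (b (n + 1))"
      using bitrajectory_step[OF assms(1), of n] bitrajectory_step[OF assms(1), of "n+1"]
      by (simp_all add: add.assoc)
    have "dist (f (i n) y) (b (n + 1)) < c" using d'(2) 1 n by simp
    also have "c \<le> d (i n)" using 1(1) by (simp add: c_def)
    finally have "dist (f (i (n+1)) (f (i n) y)) (b (n + 2)) < e" using d 1(1) 2 by metis
    then show "\<exists>j\<in>{1..m}. eps_chain m f e (f j y) (b (n + 2))" using 1(1) 2(1) eps_chain_step by metis
  qed (fact d')
qed

lemma omega_eps_chain:
  assumes "bitrajectory m f (b, i)" "y \<in> omega_limit (b, i)" "e > 0"
  shows "\<exists>n\<ge>p. \<exists>j\<in>{1..m}. eps_chain m f e (f j y) (b n)"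
proof -
  obtain d where d: "d > 0" "\<And>n. dist y (b n) < d \<Longrightarrow> \<exists>j\<in>{1..m}. eps_chain m f e (f j y) (b (n + 2))"
    by (rule eps_chain_near_bitrajectory[OF assms(1,3), of y]) blast
  obtain n where "n \<ge> p" "dist y (b n) < d" using omega_limitD[OF assms(2) d(1)] by blast
  then show ?thesis using d(2) by (intro exI[of _ "n+2"]) auto
qed

lemma alpha_eps_chain:
  assumes "bitrajectory m f (b, i)" "y \<in> alpha_limit (b, i)" "e > 0"
  shows "\<exists>j\<in>{1..m}. eps_chain m f e (f j y) (b p)"
proof -
  obtain d where d: "d > 0" "\<And>n. dist y (b n) < d \<Longrightarrow> \<exists>j\<in>{1..m}. eps_chain m f e (f j y) (b (n + 2))"
    by (rule eps_chain_near_bitrajectory[OF assms(1,3), of y]) blast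
  \<comment> \<open>Two steps of room, so that time \<open>n + 2\<close> does not exceed
    \<open>p\<close>.\<close>
  obtain n where n: "n \<le> p - 2" "dist y (b n) < d" using alpha_limitD[OF assms(2) d(1)] by blast
  have "eps_chain m f e (b (n + 2)) (b p)"
    using bitrajectory_chain_ge[OF assms(1), of "n+2" p] n(1) assms(3) by (simp add: chain_ge_def)
  then show ?thesis using d(2)[OF n(2)] by (blast intro: eps_chain_trans[of m f e])
qed

lemma chain_ge_alpha:
  assumes "bitrajectory m f (b, i)" "y \<in> alpha_limit (b, i)"
  shows "chain_ge m f y (b p)"
  unfolding chain_ge_def[of m f y "b p"]
proof (intro allI impI)
  fix e :: real assume "e > 0"
  then obtain j where "j \<in> {1..m}" "eps_chain m f e (f j y) (b p)"
    using alpha_eps_chain[OF assms] by blast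
  then show "eps_chain m f e y (b p)"
    using chain_ge_eps_chain_trans[OF chain_ge_map] \<open>e > 0\<close> by blast
qed

text \<open>The first conclusion, with chains starting at an image of \<open>y\<close>, is the form
  that proves recurrence when \<open>z = y\<close>; prepending the map \<open>f j\<close> gives the
  second.\<close>

lemma omega_limit_chain_ge:
  assumes "bitrajectory m f (b, i)" "y \<in> omega_limit (b, i)" "\<And>n. n \<ge> p \<Longrightarrow> chain_ge m f (b n) z"
  shows "\<forall>e>0. \<exists>j\<in>{1..m}. eps_chain m f e (f j y) z" "chain_ge m f y z"
proof -
  show *: "\<forall>e>0. \<exists>j\<in>{1..m}. eps_chain m f e (f j y) z"
  proof (intro allI impI)
    fix e :: real assume "e > 0"
    obtain n j where "n \<ge> p" "j \<in> {1..m}" "eps_chain m f e (f j y) (b n)"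
      using omega_eps_chain[OF assms(1,2) \<open>e > 0\<close>] by blast
    then show "\<exists>j\<in>{1..m}. eps_chain m f e (f j y) z"
      using assms(3)[of n] \<open>e > 0\<close> eps_chain_chain_ge_trans by metis
  qed
  show "chain_ge m f y z"
    unfolding chain_ge_def[of m f y z]
  proof (intro allI impI)
    fix e :: real assume "e > 0"
    then obtain j where "j \<in> {1..m}" "eps_chain m f e (f j y) z" using * by blast
    then show "eps_chain m f e y z"
      using chain_ge_eps_chain_trans[OF chain_ge_map] \<open>e > 0\<close> by blast
  qed
qed

lemma alpha_limit_chain_ge:
  assumes "bitrajectory m f (b, i)" "z \<in> alpha_limit (b, i)" "\<And>n. n \<le> p \<Longrightarrow> chain_ge m f y (b n)"
  shows "chain_ge m f y z"
  unfolding chain_ge_def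
proof (intro allI impI)
  fix e :: real assume "e > 0"
  obtain n where n: "n \<le> p" "dist z (b n) < e" using alpha_limitD[OF assms(2) \<open>e > 0\<close>] by blast
  have "chain_ge m f y (b (n - 1))" using assms(3) n(1) by simp
  then show "eps_chain m f e y z"
    using bitrajectory_eps_chain_to_limit[OF assms(1) n(2)] \<open>e > 0\<close> by (rule chain_ge_eps_chain_trans)
qed

text \<open>Up to any accuracy a limit point, and even an image of it, reaches late points of
  \<open>b\<close>, and these reach every limit point.\<close>

lemma omega_limit_in_node:
  assumes "bitrajectory m f (b, i)" "omega_limit (b, i) \<noteq> {}"
  shows "\<exists>N\<in>chain_nodes m f. omega_limit (b, i) \<subseteq> N"
proof (rule ex_chain_node_superset[OF assms(2)])
  fix y z assume y: "y \<in> omega_limit (b, i)" and z: "z \<in> omega_limit (b, i)"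
  show "chain_ge m f y z"
    by (rule omega_limit_chain_ge(2)[OF assms(1) y, of 0]) (rule chain_ge_omega[OF assms(1) z])
next
  fix y assume y: "y \<in> omega_limit (b, i)"
  show "chain_recurrent m f y"
  proof (rule chain_recurrentI)
    have "\<forall>e>0. \<exists>j\<in>{1..m}. eps_chain m f e (f j y) y"
      by (rule omega_limit_chain_ge(1)[OF assms(1) y, of 0]) (rule chain_ge_omega[OF assms(1) y])
    then show "\<exists>j\<in>{1..m}. eps_chain m f e (f j y) y" if "e > 0" for e using that by blast
  qed
qed

lemma alpha_limit_in_node:
  assumes "bitrajectory m f (b, i)" "alpha_limit (b, i) \<noteq> {}"
  shows "\<exists>N\<in>chain_nodes m f. alpha_limit (b, i) \<subseteq> N"
proof (rule ex_chain_node_superset[OF assms(2)])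
  fix y z assume "y \<in> alpha_limit (b, i)" "z \<in> alpha_limit (b, i)"
  then show "chain_ge m f y z"
    by (intro alpha_limit_chain_ge[OF assms(1), of z 0] chain_ge_alpha[OF assms(1)])
next
  fix y assume y: "y \<in> alpha_limit (b, i)"
  show "chain_recurrent m f y"
  proof (rule chain_recurrentI)
    fix e :: real assume "e > 0"
    \<comment> \<open>A loop at \<open>y\<close>: an image of \<open>y\<close> leads to
      \<open>b (n - 1)\<close>, whose next step is bent back to \<open>y\<close>.\<close>
    obtain n where "dist y (b n) < e" using alpha_limitD[OF y \<open>e > 0\<close>] by blast
    then have "eps_chain m f e (b (n - 1)) y" by (rule bitrajectory_eps_chain_to_limit[OF assms(1)])
    then show "\<exists>j\<in>{1..m}. eps_chain m f e (f j y) y"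
      using alpha_eps_chain[OF assms(1) y \<open>e > 0\<close>, of "n - 1"] by (blast intro: eps_chain_trans[of m f e])
  qed
qed

lemma chain_ge_word: "I \<in> lists {1..m} \<Longrightarrow> chain_ge m f x (fold f I x)"
proof (induction I arbitrary: x)
  case (Cons i I)
  then show ?case using chain_ge_trans[OF chain_ge_map, of i m f x] by simp
qed simp

lemma map_in_orbit: "y \<in> orbit m f x \<Longrightarrow> i \<in> {1..m} \<Longrightarrow> f i y \<in> orbit m f x"
proof -
  assume "y \<in> orbit m f x" "i \<in> {1..m}"
  then obtain I where "I \<in> lists {1..m}" "y = fold f I x" by (auto simp: orbit_def)
  then show ?thesis using \<open>i \<in> {1..m}\<close> unfolding orbit_def
    by (intro image_eqI[of _ _ "I @ [i]"]) auto
qed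

end

subsection \<open>The global attractor\<close>

locale attractor_ifs = cts_ifs m f
  for m :: nat and f :: "nat \<Rightarrow> 'a::metric_space \<Rightarrow> 'a" +
  fixes G :: "'a set"
  assumes locally_compact: "locally_compact_space (euclidean :: 'a topology)"
    and attractor: "global_attractor m f G"
begin

lemma compact_G: "compact G"
  using attractor by (simp add: global_attractor_def)

lemma map_in_G: "i \<in> {1..m} \<Longrightarrow> y \<in> G \<Longrightarrow> f i y \<in> G"
  using attractor unfolding global_attractor_def H_invariant_def hutchinson_def by blast

lemma word_in_G: "I \<in> lists {1..m} \<Longrightarrow> y \<in> G \<Longrightarrow> fold f I y \<in> G"
proof (induction I arbitrary: y)
  case (Cons i I)
  then show ?case using map_in_G[of i y] by simp
qed simp

section \<open>Compact and trapping neighbourhoods of the attractor\<close>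

text \<open>Local compactness encloses \<open>G\<close> in a compact neighbourhood, which contains a
  thin closed tube. The condition \<open>G \<noteq> {}\<close> appears because
  \<open>infdist y {} = 0\<close> would turn the tube into the whole space.\<close>

lemma compact_tube:
  obtains r where "r > 0" "\<And>d. d \<le> r \<Longrightarrow> G \<noteq> {} \<Longrightarrow> compact {y. infdist y G \<le> d}"
proof -
  have "compactin euclidean G" using compact_G by simp
  then obtain U K where K: "open U" "compact K" "G \<subseteq> U" "U \<subseteq> K"
    using locally_compact locally_compact_space_compact_closed_compact[of "euclidean :: 'a topology"]
    by (auto simp: compactin_euclidean_iff)
  obtain r where r: "r > 0" "(\<Union>y\<in>G. ball y r) \<subseteq> U"
    using compact_subset_open_imp_ball_epsilon_subset[OF compact_G K(1,3)] by metis
  show ?thesis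
  proof
    \<comment> \<open>Half the radius makes the bound by \<open>r\<close> strict, so some point of
      \<open>G\<close> lies within \<open>r\<close>.\<close>
    show "r/2 > 0" using r(1) by simp
    fix d assume d: "d \<le> r/2" and "G \<noteq> {}"
    have "{y. infdist y G \<le> d} \<subseteq> K"
    proof
      fix y assume "y \<in> {y. infdist y G \<le> d}"
      then have "infdist y G < r" using d r(1) by simp
      then obtain a where "a \<in> G" "dist y a < r"
        using \<open>G \<noteq> {}\<close> by (metis infdist_notempty cINF_less_iff bdd_below_image_dist)
      then have "y \<in> (\<Union>y\<in>G. ball y r)" by (auto simp: dist_commute)
      then show "y \<in> K" using r(2) K(4) by blast
    qed
    moreover have "closed {y. infdist y G \<le> d}"
      by (intro closed_Collect_le continuous_intros)
    ultimately show "compact {y. infdist y G \<le> d}"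
      by (metis K(2) closed_Int_compact inf.absorb1)
  qed
qed

text \<open>
  Shrinking the tube radius linearly in the length of the word makes the forward invariant
  neighbourhood of points whose first \<open>\<tau>\<close> iterates stay in the tube map into its own interior.
\<close>

lemma trapping_neighbourhood:
  assumes "d > 0" "compact {y. infdist y G \<le> d}" "G \<noteq> {}"
  obtains e where "e > 0" "\<And>x y. x \<in> G \<Longrightarrow> eps_chain m f e x y \<Longrightarrow> infdist y G \<le> d"
proof -
  \<comment> \<open>The compact tube is itself attracted: long words bring it within
    \<open>d/2\<close> of \<open>G\<close>.\<close>
  have "attracts m f G {y. infdist y G \<le> d}" "d/2 > 0"
    using attractor assms by (auto simp: global_attractor_def)
  then obtain t :: nat where t: "t > 0" "\<And>I. I \<in> lists {1..m} \<Longrightarrow> length I \<ge> t \<Longrightarrow>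
      fold f I ` {y. infdist y G \<le> d} \<subseteq> nbhd (d/2) G"
    unfolding attracts_def by metis
  \<comment> \<open>The allowed distance falls from \<open>d\<close> for the empty word to
    \<open>d/2\<close> at length \<open>t\<close>; the strict drop at each letter turns the closed
    conditions of \<open>U\<close> into the open ones of \<open>W\<close>.\<close>
  define r where "r j = d * (1 - real j / (2 * real t))" for j :: nat
  define L where "L = {I \<in> lists {1..m}. length I < t}"
  define U where "U = (\<Inter>I\<in>L. {y. infdist (fold f I y) G \<le> r (length I)})"
  define W where "W = (\<Inter>I\<in>L. {y. infdist (fold f I y) G < r (length I)})"
  have r_less: "r (Suc j) < r j" for j
    using t(1) assms(1) by (simp add: r_def field_simps)
  have r_ge: "d/2 < r j" if "j < t" for j
    using that t(1) assms(1) by (simp add: r_def field_simps)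
  have "L \<subseteq> {I. set I \<subseteq> {1..m} \<and> length I \<le> t}" by (auto simp: L_def lists_eq_set)
  then have "finite L" using finite_lists_length_le[of "{1..m}" t] finite_subset by blast
  have "[] \<in> L" using t(1) by (simp add: L_def)
  then have U_tube: "U \<subseteq> {y. infdist y G \<le> d}" by (force simp: U_def r_def)
  have "closed U" unfolding U_def
    by (intro closed_INT ballI closed_Collect_le continuous_intros) (auto simp: L_def continuous_word)
  then have "compact U" using U_tube by (metis assms(2) closed_Int_compact inf.absorb1)
  have "open W" unfolding W_def using \<open>finite L\<close>
    by (intro open_INT ballI open_Collect_less continuous_intros) (auto simp: L_def continuous_word)
  have "W \<subseteq> U" by (force simp: U_def W_def)
  have UW: "hutchinson m f U \<subseteq> W"
  proof
    fix z assume "z \<in> hutchinson m f U"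
    then obtain i y where i: "i \<in> {1..m}" "y \<in> U" "z = f i y" by (auto simp: hutchinson_def)
    have "infdist (fold f I z) G < r (length I)" if "I \<in> L" for I
    \<comment> \<open>If \<open>i # I\<close> is still shorter than \<open>t\<close>, membership in
      \<open>U\<close> and the drop of \<open>r\<close> suffice; otherwise attraction takes over,
      and \<open>d/2\<close> lies below every allowed bound.\<close>
    proof (cases "Suc (length I) < t")
      case True
      then have "i # I \<in> L" using that i(1) by (simp add: L_def)
      then have "infdist (fold f (i # I) y) G \<le> r (length (i # I))" using i(2) by (auto simp: U_def)
      then show ?thesis using r_less[of "length I"] i(3) by simp
    next
      case False
      then have "fold f (i # I) ` {y. infdist y G \<le> d} \<subseteq> nbhd (d/2) G"
        using that i(1) by (intro t(2)) (auto simp: L_def)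
      then have "fold f (i # I) y \<in> nbhd (d/2) G" using i(2) U_tube by blast
      then obtain a where "a \<in> G" "dist (fold f I z) a < d/2" using i(3) by (auto simp: nbhd_def)
      then have "infdist (fold f I z) G < d/2" using infdist_le order_le_less_trans by blast
      then show ?thesis using r_ge[of "length I"] that by (simp add: L_def)
    qed
    then show "z \<in> W" by (simp add: W_def)
  qed
  have "compact (hutchinson m f U)" unfolding hutchinson_def
    using \<open>compact U\<close> by (intro compact_UN finite_atLeastAtMost compact_continuous_image continuous_map)
  \<comment> \<open>The compact image of \<open>U\<close> has a uniform margin inside the open set
    \<open>W\<close>, so a jump of this size from \<open>U\<close> stays in
    \<open>U\<close>.\<close>
  then obtain e where e: "e > 0" "(\<Union>y\<in>hutchinson m f U. ball y e) \<subseteq> W"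
    using compact_subset_open_imp_ball_epsilon_subset[OF _ \<open>open W\<close> UW] by metis
  have GU: "G \<subseteq> U"
  proof
    fix y assume "y \<in> G"
    have "0 \<le> r (length I)" if "I \<in> L" for I
      using r_ge[of "length I"] that assms(1) by (simp add: L_def)
    then show "y \<in> U" using word_in_G[OF _ \<open>y \<in> G\<close>] by (auto simp: U_def L_def)
  qed
  have "y \<in> U" if "x \<in> G" "eps_chain m f e x y" for x y
    using that(2) unfolding eps_chain_iff_rtranclp
  proof (induction rule: rtranclp_induct)
    case base
    then show ?case using GU that(1) by blast
  next
    case (step y z)
    then obtain i where "i \<in> {1..m}" "dist (f i y) z < e" by (auto simp: eps_step_def)
    then have "z \<in> (\<Union>y\<in>hutchinson m f U. ball y e)" using step.IH by (auto simp: hutchinson_def)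
    then show ?case using e(2) \<open>W \<subseteq> U\<close> by blast
  qed
  then show ?thesis using that[OF e(1)] U_tube by blast
qed

text \<open>The endpoints eventually lie in every thin tube around \<open>G\<close>. One such tube
  is compact, which gives a limit, and this limit has distance \<open>0\<close> from the closed set
  \<open>G\<close>.\<close>

lemma eps_chains_converge_in_G:
  assumes "x \<in> G" "\<And>n. eps_chain m f (1 / Suc n) x (y n)"
  obtains l r where "l \<in> G" "strict_mono (r :: nat \<Rightarrow> nat)" "(y \<circ> r) \<longlonglongrightarrow> l"
proof -
  have ne: "G \<noteq> {}" using assms(1) by blast
  obtain d0 where d0: "d0 > 0" "\<And>d. d \<le> d0 \<Longrightarrow> compact {y. infdist y G \<le> d}"
    using compact_tube ne by metis
  have ev: "\<forall>\<^sub>F n in sequentially. infdist (y n) G \<le> d" if d: "0 < d" "d \<le> d0" for d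
  proof -
    obtain e where e: "e > 0" "\<And>x y. x \<in> G \<Longrightarrow> eps_chain m f e x y \<Longrightarrow> infdist y G \<le> d"
      using trapping_neighbourhood[OF d(1) d0(2)[OF d(2)] ne] by metis
    have "\<forall>\<^sub>F n in sequentially. 1 / real (Suc n) < e"
      using LIMSEQ_inverse_real_of_nat e(1) by (auto dest!: order_tendstoD(2) simp: inverse_eq_divide)
    then show ?thesis
      by eventually_elim (meson assms e(2) eps_chain_mono less_imp_le)
  qed
  obtain k where k: "\<And>n. n \<ge> k \<Longrightarrow> infdist (y n) G \<le> d0"
    using ev[of d0] d0(1) by (auto simp: eventually_sequentially)
  have "\<forall>n. y (n + k) \<in> {y. infdist y G \<le> d0}" using k by simp
  then obtain l s where s: "strict_mono s" "((\<lambda>n. y (n + k)) \<circ> s) \<longlonglongrightarrow> l"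
    using d0(2)[of d0] by (meson compact_eq_seq_compact_metric order_refl seq_compactE)
  \<comment> \<open>The shift by \<open>k\<close> drops the terms that may lie outside the compact
    tube.\<close>
  define r where "r n = s n + k" for n
  have r: "strict_mono r" "(y \<circ> r) \<longlonglongrightarrow> l"
    using s by (auto simp: r_def o_def strict_mono_def)
  \<comment> \<open>Trapping is available for radii up to \<open>d0\<close> only, hence the minimum
    below.\<close>
  have "infdist l G \<le> d" if "d > 0" for d
  proof -
    have "\<forall>\<^sub>F n in sequentially. infdist (y (r n)) G \<le> min d d0"
      using ev[of "min d d0"] that d0(1) filterlim_subseq[OF r(1)]
      by (auto intro: eventually_compose_filterlim)
    then have "\<forall>\<^sub>F n in sequentially. infdist ((y \<circ> r) n) G \<le> min d d0"
      by (simp only: o_apply)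
    then have "infdist l G \<le> min d d0"
      by (rule tendsto_upperbound[OF tendsto_infdist[OF r(2), of G] _ sequentially_bot])
    then show ?thesis by simp
  qed
  then have "infdist l G \<le> 0" by (rule field_le_epsilon) simp
  then have "l \<in> G"
    using in_closed_iff_infdist_zero[OF compact_imp_closed[OF compact_G] ne] infdist_nonneg[of l G] by simp
  then show ?thesis using r by (rule that)
qed

section \<open>Trajectories inside the node of a recurrent point, and prescribed futures\<close>

text \<open>The penultimate points of ever finer loops at \<open>x\<close> accumulate at a point
  \<open>l\<close> of \<open>G\<close>; by continuity some letter maps \<open>l\<close> to
  \<open>x\<close>, and \<open>x\<close> reaches \<open>l\<close> because the loops pass close to
  it.\<close>

lemma recurrent_preimage:
  assumes "x \<in> G" "chain_recurrent m f x"
  shows "\<exists>y\<in>G. chain_equivalent m f x y \<and> (\<exists>i\<in>{1..m}. x = f i y)"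
proof -
  obtain i0 where i0: "i0 \<in> {1..m}" "chain_ge m f (f i0 x) x"
    using assms(2) by (auto simp: chain_recurrent_iff)
  have "\<exists>y. eps_chain m f e x y \<and> (\<exists>i\<in>{1..m}. dist (f i y) x < e)" if "e > 0" for e
  proof -
    \<comment> \<open>Starting with the exact step to \<open>f i0 x\<close> makes the loop nonempty,
      so a penultimate point exists.\<close>
    have "eps_step m f e x (f i0 x)"
      unfolding eps_step_def using i0(1) that by (intro bexI[of _ i0]) auto
    moreover have "(eps_step m f e)\<^sup>*\<^sup>* (f i0 x) x"
      using i0(2) that by (simp add: chain_ge_def eps_chain_iff_rtranclp)
    ultimately have "(eps_step m f e)\<^sup>+\<^sup>+ x x" by (rule rtranclp_into_tranclp2)
    then obtain y where "(eps_step m f e)\<^sup>*\<^sup>* x y" "eps_step m f e y x"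
      by (metis rtranclp.rtrancl_refl tranclp.cases tranclp_into_rtranclp)
    then show ?thesis by (auto simp: eps_step_def eps_chain_iff_rtranclp)
  qed
  then have "\<forall>n. \<exists>y. eps_chain m f (1 / Suc n) x y \<and> (\<exists>i\<in>{1..m}. dist (f i y) x < 1 / Suc n)" by simp
  then obtain y where y: "\<And>n. eps_chain m f (1 / Suc n) x (y n)"
      "\<And>n. \<exists>i\<in>{1..m}. dist (f i (y n)) x < 1 / Suc n" by metis
  obtain l r where l: "l \<in> G" "strict_mono r" "(y \<circ> r) \<longlonglongrightarrow> l"
    using eps_chains_converge_in_G[OF assms(1) y(1)] by metis
  \<comment> \<open>One index serves both purposes: \<open>y n\<close> is near \<open>l\<close>, and
    the chain to \<open>y n\<close> is fine.\<close>
  have close: "\<exists>n. dist (y n) l < e \<and> 1 / Suc n < e" if "e > 0" for e :: real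
  proof -
    have "\<forall>\<^sub>F n in sequentially. dist ((y \<circ> r) n) l < e" using l(3) that by (rule tendstoD)
    moreover have "\<forall>\<^sub>F n in sequentially. 1 / real (Suc n) < e"
      using LIMSEQ_inverse_real_of_nat that by (auto dest!: order_tendstoD(2) simp: inverse_eq_divide)
    then have "\<forall>\<^sub>F n in sequentially. 1 / real (Suc (r n)) < e"
      using filterlim_subseq[OF l(2)] by (rule eventually_compose_filterlim)
    ultimately have "\<forall>\<^sub>F n in sequentially. dist (y (r n)) l < e \<and> 1 / real (Suc (r n)) < e"
      by (auto intro: eventually_conj)
    then obtain n where "dist (y (r n)) l < e \<and> 1 / real (Suc (r n)) < e"
      using eventually_happens'[OF sequentially_bot] by blast
    then show ?thesis by blast
  qed
  \<comment> \<open>With one letter for all \<open>e\<close>, the bounds force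
    \<open>f i l = x\<close>.\<close>
  have "\<exists>i\<in>{1..m}. \<forall>e>0. dist (f i l) x < e"
  proof (rule finite_uniform_choice)
    fix e :: real assume "e > 0"
    obtain d where d: "d > 0" "\<And>i z. i \<in> {1..m} \<Longrightarrow> dist l z < d \<Longrightarrow> dist (f i l) (f i z) < e/2"
      using maps_equicontinuous_at[of "e/2" l] \<open>e > 0\<close> by auto
    obtain n where n: "dist (y n) l < d" "1 / Suc n < e/2"
      using close[of "min d (e/2)"] d(1) \<open>e > 0\<close> by auto
    obtain i where i: "i \<in> {1..m}" "dist (f i (y n)) x < 1 / Suc n" using y(2) by blast
    have "dist (f i l) (f i (y n)) < e/2" using d(2) i(1) n(1) by (simp add: dist_commute[of _ l])
    then have "dist (f i l) x < e" using i(2) n(2) dist_triangle[of "f i l" x "f i (y n)"] by linarith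
    then show "\<exists>i\<in>{1..m}. dist (f i l) x < e" using i(1) by blast
  qed auto
  then obtain i where i: "i \<in> {1..m}" "x = f i l"
    by (metis dist_pos_lt less_irrefl)
  have "chain_ge m f x l"
    by (rule chain_ge_closed) (meson close eps_chain_mono less_imp_le y(1))
  then have "chain_equivalent m f x l"
    using chain_ge_map[OF i(1), of f l] i(2) by (simp add: chain_equivalent_def)
  then show ?thesis using i l(1) by blast
qed

lemma recurrent_image:
  assumes "x \<in> G" "chain_recurrent m f x"
  shows "\<exists>y\<in>G. chain_equivalent m f x y \<and> (\<exists>i\<in>{1..m}. y = f i x)"
  using assms map_in_G by (auto simp: chain_recurrent_def)

text \<open>Chain-equivalence passes recurrence on to the preimage, so preimages in the same class
  can be chosen again and again.\<close>

lemma recurrent_backward_sequence: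
  assumes "x \<in> G" "chain_recurrent m f x"
  obtains u where "u 0 = x" "\<And>n. \<exists>i\<in>{1..m}. u n = f i (u (Suc n))" "range u \<subseteq> G"
    "\<And>n. chain_equivalent m f x (u n)"
proof -
  \<comment> \<open>The clause on \<open>n = 0\<close> anchors the sequence at \<open>x\<close>,
    since dependent choice by itself prescribes no starting value.\<close>
  have "\<exists>u. \<forall>n. (u n \<in> G \<and> chain_equivalent m f x (u n) \<and> (n = 0 \<longrightarrow> u n = x)) \<and>
      (\<exists>i\<in>{1..m}. u n = f i (u (Suc n)))"
  proof (rule dependent_nat_choice)
    fix y and n :: nat
    assume y: "y \<in> G \<and> chain_equivalent m f x y \<and> (n = 0 \<longrightarrow> y = x)"
    then have "chain_recurrent m f y" using assms(2) chain_recurrent_iff_equivalent by blast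
    then obtain z where "z \<in> G" "chain_equivalent m f y z" "\<exists>i\<in>{1..m}. y = f i z"
      using recurrent_preimage y by blast
    then show "\<exists>z. (z \<in> G \<and> chain_equivalent m f x z \<and> (Suc n = 0 \<longrightarrow> z = x)) \<and> (\<exists>i\<in>{1..m}. y = f i z)"
      using y chain_equivalent_trans[of m f x y z] by blast
  qed (use assms(1) in auto)
  then show ?thesis using that by (metis image_subsetI)
qed

lemma recurrent_forward_sequence:
  assumes "x \<in> G" "chain_recurrent m f x"
  obtains v where "v 0 = x" "\<And>n. \<exists>i\<in>{1..m}. v (Suc n) = f i (v n)" "range v \<subseteq> G"
    "\<And>n. chain_equivalent m f x (v n)"
proof -
  have "\<exists>v. \<forall>n. (v n \<in> G \<and> chain_equivalent m f x (v n) \<and> (n = 0 \<longrightarrow> v n = x)) \<and>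
      (\<exists>i\<in>{1..m}. v (Suc n) = f i (v n))"
  proof (rule dependent_nat_choice)
    fix y and n :: nat
    assume y: "y \<in> G \<and> chain_equivalent m f x y \<and> (n = 0 \<longrightarrow> y = x)"
    then have "chain_recurrent m f y" using assms(2) chain_recurrent_iff_equivalent by blast
    then obtain z where "z \<in> G" "chain_equivalent m f y z" "\<exists>i\<in>{1..m}. z = f i y"
      using recurrent_image y by blast
    then show "\<exists>z. (z \<in> G \<and> chain_equivalent m f x z \<and> (Suc n = 0 \<longrightarrow> z = x)) \<and> (\<exists>i\<in>{1..m}. z = f i y)"
      using y chain_equivalent_trans[of m f x y z] by blast
  qed (use assms(1) in auto)
  then show ?thesis using that by (metis image_subsetI)
qed

lemma forward_sequence_through:
  assumes "x \<in> G" "y \<in> orbit m f x"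
  obtains v k where "v 0 = x" "\<And>n. \<exists>i\<in>{1..m}. v (Suc n) = f i (v n)" "range v \<subseteq> G" "v (k::nat) = y"
proof -
  obtain I where I: "I \<in> lists {1..m}" "y = fold f I x" using assms(2) by (auto simp: orbit_def)
  \<comment> \<open>Beyond the word the trajectory must continue; the letter \<open>1\<close> exists
    because \<open>1 \<le> m\<close>.\<close>
  define s where "s n = (if n < length I then I ! n else 1)" for n
  have s: "s n \<in> {1..m}" for n
    using I(1) one_le_m by (auto simp: s_def lists_eq_set dest!: nth_mem)
  define v where "v n = fold f (map s [0..<n]) x" for n
  have "map s [0..<length I] = I" by (rule nth_equalityI) (auto simp: s_def)
  then have "v (length I) = y" by (simp add: v_def I(2))
  moreover have "range v \<subseteq> G"
    unfolding v_def using s by (auto intro!: word_in_G assms(1))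
  moreover have "v (Suc n) = f (s n) (v n)" for n by (simp add: v_def)
  ultimately show ?thesis using that[of v "length I"] s by (force simp: v_def)
qed

text \<open>A bitrajectory may meet \<open>x\<close> at any time \<open>p\<close>; reading it
  backwards from there puts \<open>x\<close> at index \<open>0\<close>, as splicing expects.\<close>

lemma backward_sequence_of_bitrajectory:
  assumes "(b, i) \<in> bitrajectories_through m f G x"
  obtains u p where "u 0 = x" "\<And>n. \<exists>j\<in>{1..m}. u n = f j (u (Suc n))" "range u \<subseteq> G"
    "\<And>n. u n = b (p - int n)"
proof -
  obtain p where p: "b p = x" and b: "bitrajectory m f (b, i)" "range b \<subseteq> G"
    using assms by (auto simp: bitrajectories_through_def)
  have "\<exists>j\<in>{1..m}. b (p - int n) = f j (b (p - int (Suc n)))" for n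
    using bitrajectory_step[OF b(1), of "p - int (Suc n)"] by auto
  then show ?thesis using that[of "\<lambda>n. b (p - int n)" p] p b(2) by auto
qed

section \<open>Limit sets of bitrajectories in the attractor\<close>

lemma limit_sets:
  assumes "\<beta> \<in> bitrajectories_through m f G x"
  shows "alpha_limit \<beta> \<noteq> {}" "omega_limit \<beta> \<noteq> {}"
    and "\<exists>N\<in>chain_nodes m f. alpha_limit \<beta> \<subseteq> N" "\<exists>N\<in>chain_nodes m f. omega_limit \<beta> \<subseteq> N"
    and "\<And>w. w \<in> alpha_limit \<beta> \<Longrightarrow> chain_ge m f w x"
    and "\<And>z. z \<in> omega_limit \<beta> \<Longrightarrow> chain_ge m f x z"
proof -
  obtain b i p where \<beta>: "\<beta> = (b, i)" and b: "bitrajectory m f (b, i)" "b p = x" "range b \<subseteq> G"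
    using assms by (auto simp: bitrajectories_through_def)
  show ne: "alpha_limit \<beta> \<noteq> {}" "omega_limit \<beta> \<noteq> {}"
    unfolding \<beta> using alpha_limit_nonempty omega_limit_nonempty compact_G b(3) by blast+
  show "\<exists>N\<in>chain_nodes m f. alpha_limit \<beta> \<subseteq> N" "\<exists>N\<in>chain_nodes m f. omega_limit \<beta> \<subseteq> N"
    using alpha_limit_in_node[OF b(1)] omega_limit_in_node[OF b(1)] ne unfolding \<beta> by blast+
  show "chain_ge m f w x" if "w \<in> alpha_limit \<beta>" for w
    using chain_ge_alpha[OF b(1), of w p] that b(2) \<beta> by simp
  show "chain_ge m f x z" if "z \<in> omega_limit \<beta>" for z
    using chain_ge_omega[OF b(1), of z p] that b(2) \<beta> by simp
qed

text \<open>Limit points of the past always reach \<open>x\<close>; the assumption on the past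
  provides the way from \<open>x\<close> to them, and recurrence is invariant under
  chain-equivalence.\<close>

lemma alpha_limit_subset_node:
  assumes N: "N \<in> chain_nodes m f" "x \<in> N"
    and \<beta>: "(b, i) \<in> bitrajectories_through m f G x"
    and past: "\<And>n. n \<le> p \<Longrightarrow> chain_ge m f x (b n)"
  shows "alpha_limit (b, i) \<subseteq> N"
proof
  fix y assume y: "y \<in> alpha_limit (b, i)"
  have "bitrajectory m f (b, i)" using \<beta> by (auto simp: bitrajectories_through_def)
  then have "chain_ge m f x y" using y past by (rule alpha_limit_chain_ge)
  then have "chain_equivalent m f x y" using limit_sets(5)[OF \<beta> y] by (simp add: chain_equivalent_def)
  then show "y \<in> N" using N chain_node_memI chain_node_recurrent chain_recurrent_iff_equivalent by blast
qed

lemma omega_limit_subset_node: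
  assumes N: "N \<in> chain_nodes m f" "x \<in> N"
    and \<beta>: "(b, i) \<in> bitrajectories_through m f G x"
    and future: "\<And>n. n \<ge> p \<Longrightarrow> chain_ge m f (b n) x"
  shows "omega_limit (b, i) \<subseteq> N"
proof
  fix y assume y: "y \<in> omega_limit (b, i)"
  have "bitrajectory m f (b, i)" using \<beta> by (auto simp: bitrajectories_through_def)
  then have "chain_ge m f y x" using y future by (rule omega_limit_chain_ge(2))
  then have "chain_equivalent m f x y" using limit_sets(6)[OF \<beta> y] by (simp add: chain_equivalent_def)
  then show "y \<in> N" using N chain_node_memI chain_node_recurrent chain_recurrent_iff_equivalent by blast
qed

text \<open>A backward and a forward sequence of points chain-equivalent to \<open>x\<close> are
  spliced, which keeps both limit sets in the node.\<close>

lemma recurrent_bitrajectory: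
  assumes "x \<in> G" "N \<in> chain_nodes m f" "x \<in> N"
  shows "\<exists>\<beta>\<in>bitrajectories_through m f G x. alpha_limit \<beta> \<subseteq> N \<and> omega_limit \<beta> \<subseteq> N"
proof -
  have rec: "chain_recurrent m f x" using assms chain_node_recurrent by blast
  obtain u where u: "u 0 = x" "\<And>n. \<exists>i\<in>{1..m}. u n = f i (u (Suc n))" "range u \<subseteq> G"
    "\<And>n. chain_equivalent m f x (u n)"
    by (rule recurrent_backward_sequence[OF assms(1) rec]) blast
  obtain v where v: "v 0 = x" "\<And>n. \<exists>i\<in>{1..m}. v (Suc n) = f i (v n)" "range v \<subseteq> G"
    "\<And>n. chain_equivalent m f x (v n)"
    by (rule recurrent_forward_sequence[OF assms(1) rec]) blast
  obtain b i where b: "(b, i) \<in> bitrajectories_through m f G x"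
    "\<And>n. b (int n) = v n" "\<And>n. b (- int n) = u n"
    by (rule splice_bitrajectory[OF u(1,2) v(1,2) u(3) v(3)]) blast
  have "chain_ge m f x (b n)" if "n \<le> 0" for n
    using u(4)[of "nat (- n)"] b(3)[of "nat (- n)"] that by (simp add: chain_equivalent_def)
  moreover have "chain_ge m f (b n) x" if "n \<ge> 0" for n
    using v(4)[of "nat n"] b(2)[of "nat n"] that by (simp add: chain_equivalent_def)
  ultimately show ?thesis
    using alpha_limit_subset_node[OF assms(2,3) b(1)] omega_limit_subset_node[OF assms(2,3) b(1)] b(1)
    by blast
qed

text \<open>The past of \<open>\<beta>\<close> is kept and its future replaced by a trajectory that
  visits \<open>y\<close>, so \<open>y\<close> reaches all limit points of the new future.\<close>

lemma bitrajectory_via: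
  assumes "x \<in> G" "\<beta> \<in> bitrajectories_through m f G x" "y \<in> orbit m f x"
    and "alpha_limit \<beta> \<subseteq> N" "N \<in> chain_nodes m f"
  shows "\<exists>\<gamma>\<in>bitrajectories_through m f G x. alpha_limit \<gamma> \<subseteq> N \<and>
    (\<forall>z\<in>omega_limit \<gamma>. chain_ge m f y z)"
proof -
  obtain b i where \<beta>: "\<beta> = (b, i)" by (cases \<beta>)
  obtain u p where u: "u 0 = x" "\<And>n. \<exists>j\<in>{1..m}. u n = f j (u (Suc n))" "range u \<subseteq> G"
    "\<And>n. u n = b (p - int n)"
    by (rule backward_sequence_of_bitrajectory[OF assms(2)[unfolded \<beta>]]) blast
  obtain v k where v: "v 0 = x" "\<And>n. \<exists>i\<in>{1..m}. v (Suc n) = f i (v n)" "range v \<subseteq> G" "v (k::nat) = y"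
    by (rule forward_sequence_through[OF assms(1,3)]) blast
  obtain c j where c: "(c, j) \<in> bitrajectories_through m f G x"
    "\<And>n. c (int n) = v n" "\<And>n. c (- int n) = u n"
    by (rule splice_bitrajectory[OF u(1,2) v(1,2) u(3) v(3)]) blast
  have bi: "bitrajectory m f (c, j)" using c(1) by (simp add: bitrajectories_through_def)
  have "chain_ge m f y z" if "z \<in> omega_limit (c, j)" for z
    using chain_ge_omega[OF bi that, of "int k"] c(2) v(4) by simp
  \<comment> \<open>The two pasts coincide up to the shift by \<open>p\<close>, which limits at
    minus infinity ignore.\<close>
  moreover have "alpha_limit (c, j) \<subseteq> alpha_limit (b, i)"
  proof
    fix w assume "w \<in> alpha_limit (c, j)"
    then obtain n :: "nat \<Rightarrow> int" where n: "filterlim n at_bot sequentially" "(\<lambda>l. c (n l)) \<longlonglongrightarrow> w"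
      by (auto simp: alpha_limit_def)
    have cb: "c t = b (p + t)" if "t \<le> 0" for t
      using c(3)[of "nat (- t)"] u(4)[of "nat (- t)"] that by simp
    have "\<forall>\<^sub>F l in sequentially. n l \<le> 0" using n(1) by (simp add: filterlim_at_bot)
    then have "\<forall>\<^sub>F l in sequentially. c (n l) = b (p + n l)"
      by eventually_elim (rule cb)
    then have "(\<lambda>l. b (p + n l)) \<longlonglongrightarrow> w" using n(2) by (simp add: tendsto_cong)
    moreover have "filterlim (\<lambda>l. p + n l) at_bot sequentially"
      unfolding filterlim_at_bot
    proof
      fix Z :: int
      have "\<forall>\<^sub>F l in sequentially. n l \<le> Z - p" using n(1) by (simp add: filterlim_at_bot)
      then show "\<forall>\<^sub>F l in sequentially. p + n l \<le> Z" by eventually_elim simp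
    qed
    ultimately show "w \<in> alpha_limit (b, i)" by (auto simp: alpha_limit_def)
  qed
  ultimately show ?thesis using c(1) assms(4) \<beta> by blast
qed

section \<open>Characterisations of the three cases\<close>

lemma orbitwise_imp_recurrent:
  assumes "orbitwise_chain_recurrent m f x"
  shows "chain_recurrent m f x"
proof -
  have "f 1 x \<in> orbit m f x"
    unfolding orbit_def using one_le_m by (intro image_eqI[of _ _ "[1]"]) auto
  then show ?thesis using assms one_le_m
    unfolding orbitwise_chain_recurrent_def chain_recurrent_def by (intro bexI[of _ 1]) auto
qed

lemma node_of:
  assumes "chain_recurrent m f x"
  obtains N where "N \<in> chain_nodes m f" "x \<in> N"
  using ex_chain_node_superset[of "{x}" m f] assms by auto

lemma bitrajectory_in_orbit:
  assumes "bitrajectory m f (b, i)" "b p = x" "p \<le> q"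
  shows "b q \<in> orbit m f x"
  using assms(3)
proof (induction q rule: int_ge_induct)
  case base
  show ?case unfolding orbit_def using assms(2) by (intro image_eqI[of _ _ "[]"]) auto
next
  case (step q)
  then show ?case using map_in_orbit bitrajectory_step[OF assms(1), of q] by simp
qed

text \<open>From the visit to \<open>x\<close> onwards a bitrajectory consists of orbit points of
  \<open>x\<close>, each of which returns to \<open>x\<close>.\<close>

lemma orbitwise_omega_limit:
  assumes "orbitwise_chain_recurrent m f x" "N \<in> chain_nodes m f" "x \<in> N"
    and "\<beta> \<in> bitrajectories_through m f G x"
  shows "omega_limit \<beta> \<subseteq> N"
proof -
  obtain b i p where \<beta>: "\<beta> = (b, i)" and b: "bitrajectory m f (b, i)" "b p = x"
    using assms(4) by (auto simp: bitrajectories_through_def)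
  have "chain_ge m f (b n) x" if "n \<ge> p" for n
    using bitrajectory_in_orbit[OF b that] assms(1)
    by (auto simp: orbitwise_chain_recurrent_def chain_equivalent_def)
  then show ?thesis using omega_limit_subset_node[OF assms(2,3)] assms(4) \<beta> by blast
qed

text \<open>For the converse, an orbit point \<open>y\<close> reaches some \<open>z\<close> in the
  \<open>\<omega>\<close>-limit set of a bitrajectory visiting \<open>y\<close>; \<open>z\<close>
  reaches any \<open>w\<close> in the \<open>\<alpha>\<close>-limit set of \<open>b0\<close>, as
  both lie in \<open>N\<close>; and \<open>w\<close> reaches \<open>x\<close>.\<close>

lemma orbitwise_iff:
  assumes "x \<in> G"
  shows "orbitwise_chain_recurrent m f x \<longleftrightarrow>
    (\<exists>N\<in>chain_nodes m f. (\<forall>b\<in>bitrajectories_through m f G x. omega_limit b \<subseteq> N) \<and>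
      (\<exists>b0\<in>bitrajectories_through m f G x. alpha_limit b0 \<subseteq> N))"
proof
  assume orb: "orbitwise_chain_recurrent m f x"
  obtain N where N: "N \<in> chain_nodes m f" "x \<in> N"
    using node_of[OF orbitwise_imp_recurrent[OF orb]] .
  obtain b0 where b0: "b0 \<in> bitrajectories_through m f G x" "alpha_limit b0 \<subseteq> N"
    using recurrent_bitrajectory[OF assms N] by (elim bexE conjE)
  show "\<exists>N\<in>chain_nodes m f. (\<forall>b\<in>bitrajectories_through m f G x. omega_limit b \<subseteq> N) \<and>
      (\<exists>b0\<in>bitrajectories_through m f G x. alpha_limit b0 \<subseteq> N)"
    by (intro bexI[OF _ N(1)] bexI[OF _ b0(1)] conjI ballI orbitwise_omega_limit[OF orb N] b0(2))
next
  assume "\<exists>N\<in>chain_nodes m f. (\<forall>b\<in>bitrajectories_through m f G x. omega_limit b \<subseteq> N) \<and>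
      (\<exists>b0\<in>bitrajectories_through m f G x. alpha_limit b0 \<subseteq> N)"
  then obtain N b0 where N: "N \<in> chain_nodes m f" "\<And>b. b \<in> bitrajectories_through m f G x \<Longrightarrow> omega_limit b \<subseteq> N"
    and b0: "b0 \<in> bitrajectories_through m f G x" "alpha_limit b0 \<subseteq> N" by blast
  show "orbitwise_chain_recurrent m f x"
    unfolding orbitwise_chain_recurrent_def
  proof
    fix y assume y: "y \<in> orbit m f x"
    then have xy: "chain_ge m f x y" using chain_ge_word by (auto simp: orbit_def)
    obtain c where c: "c \<in> bitrajectories_through m f G x" "\<forall>z\<in>omega_limit c. chain_ge m f y z"
      using bitrajectory_via[OF assms b0(1) y b0(2) N(1)] by blast
    obtain w z where w: "w \<in> alpha_limit b0" and z: "z \<in> omega_limit c"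
      using limit_sets(1)[OF b0(1)] limit_sets(2)[OF c(1)] by blast
    have "chain_ge m f z w"
      using chain_node_equivalent[OF N(1), of z w] N(2)[OF c(1)] z w b0(2) by (auto simp: chain_equivalent_def)
    then have "chain_ge m f y x"
      using c(2) z limit_sets(5)[OF b0(1) w] chain_ge_trans by metis
    then show "chain_equivalent m f x y" using xy by (simp add: chain_equivalent_def)
  qed
qed

text \<open>Some orbit point \<open>y\<close> does not reach \<open>x\<close>. A bitrajectory with
  past in \<open>N\<close> that visits \<open>y\<close> cannot end in \<open>N\<close>, since its
  limit points would lead \<open>y\<close> back to \<open>x\<close>. Conversely, orbitwise
  recurrence would put the nonempty \<open>\<omega>\<close>-limit set of \<open>bg\<close> into
  \<open>N\<close>, which is disjoint from \<open>P\<close>.\<close>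

lemma mixed_iff:
  assumes "x \<in> G"
  shows "chain_recurrent m f x \<and> \<not> orbitwise_chain_recurrent m f x \<longleftrightarrow>
    (\<exists>N\<in>chain_nodes m f. x \<in> N \<and>
      (\<exists>br\<in>bitrajectories_through m f G x. \<exists>bg\<in>bitrajectories_through m f G x.
        \<exists>P\<in>chain_nodes m f. P \<noteq> N \<and>
         alpha_limit br \<union> omega_limit br \<subseteq> N \<and> alpha_limit bg \<subseteq> N \<and> omega_limit bg \<subseteq> P))"
    (is "_ \<longleftrightarrow> ?R")
proof
  assume "chain_recurrent m f x \<and> \<not> orbitwise_chain_recurrent m f x"
  then obtain N y where N: "N \<in> chain_nodes m f" "x \<in> N" and y: "y \<in> orbit m f x" "\<not> chain_equivalent m f x y"
    using node_of unfolding orbitwise_chain_recurrent_def by metis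
  have "chain_ge m f x y" using y(1) chain_ge_word by (auto simp: orbit_def)
  then have nyx: "\<not> chain_ge m f y x" using y(2) by (simp add: chain_equivalent_def)
  obtain br where br: "br \<in> bitrajectories_through m f G x" "alpha_limit br \<subseteq> N" "omega_limit br \<subseteq> N"
    using recurrent_bitrajectory[OF assms N] by blast
  obtain bg where bg: "bg \<in> bitrajectories_through m f G x" "alpha_limit bg \<subseteq> N"
      "\<forall>z\<in>omega_limit bg. chain_ge m f y z"
    using bitrajectory_via[OF assms br(1) y(1) br(2) N(1)] by blast
  obtain P where P: "P \<in> chain_nodes m f" "omega_limit bg \<subseteq> P" using limit_sets(4)[OF bg(1)] by blast
  obtain z where z: "z \<in> omega_limit bg" using limit_sets(2)[OF bg(1)] by blast
  have "P \<noteq> N"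
  proof
    assume "P = N"
    then have "chain_ge m f z x"
      using chain_node_equivalent[OF N(1) _ N(2), of z] z P(2) by (auto simp: chain_equivalent_def)
    then show False using nyx bg(3) z chain_ge_trans by metis
  qed
  then show ?R using N br bg(1,2) P by blast
next
  assume ?R
  then obtain N bg P where N: "N \<in> chain_nodes m f" "x \<in> N" and bg: "bg \<in> bitrajectories_through m f G x"
    and P: "P \<in> chain_nodes m f" "P \<noteq> N" "omega_limit bg \<subseteq> P" by blast
  have "\<not> orbitwise_chain_recurrent m f x"
    using orbitwise_omega_limit[OF _ N bg] limit_sets(2)[OF bg] P chain_nodes_disjoint[OF N(1) P(1)] by blast
  then show "chain_recurrent m f x \<and> \<not> orbitwise_chain_recurrent m f x"
    using N chain_node_recurrent by blast
qed

text \<open>Any \<open>w\<close> in the past limit set and \<open>z\<close> in the future one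
  satisfy \<open>w \<succcurlyeq> x \<succcurlyeq> z\<close>, which gives the edge. A common node
  would add \<open>z \<succcurlyeq> w\<close>, making \<open>x\<close> equivalent to the recurrent
  point \<open>w\<close>.\<close>

lemma gradient_distinct_nodes:
  assumes "\<not> chain_recurrent m f x" "\<beta> \<in> bitrajectories_through m f G x"
    and "N \<in> chain_nodes m f" "P \<in> chain_nodes m f" "alpha_limit \<beta> \<subseteq> N" "omega_limit \<beta> \<subseteq> P"
  shows "N \<noteq> P" "(N, P) \<in> chain_graph_edges m f"
proof -
  obtain w z where w: "w \<in> alpha_limit \<beta>" and z: "z \<in> omega_limit \<beta>"
    using limit_sets(1,2)[OF assms(2)] by blast
  have wx: "chain_ge m f w x" and xz: "chain_ge m f x z"
    using limit_sets(5,6)[OF assms(2)] w z by blast+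
  show "N \<noteq> P"
  proof
    assume "N = P"
    then have "chain_ge m f z w"
      using chain_node_equivalent[OF assms(3), of z w] assms w z by (auto simp: chain_equivalent_def)
    then have "chain_equivalent m f w x"
      using wx xz chain_ge_trans unfolding chain_equivalent_def by metis
    then show False
      using assms(1,3,5) w chain_node_recurrent chain_recurrent_iff_equivalent by blast
  qed
  then show "(N, P) \<in> chain_graph_edges m f"
    using assms(3-6) w z chain_ge_trans[OF wx xz] unfolding chain_graph_edges_def by blast
qed

text \<open>A recurrent \<open>x\<close> has a bitrajectory with both limit sets in its own node; as
  these are nonempty and nodes are disjoint, no two distinct nodes can contain them.\<close>

lemma gradient_iff:
  assumes "x \<in> G"
  shows "\<not> chain_recurrent m f x \<longleftrightarrow>
    (\<forall>b\<in>bitrajectories_through m f G x. \<exists>N\<in>chain_nodes m f. \<exists>P\<in>chain_nodes m f.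
      N \<noteq> P \<and> alpha_limit b \<subseteq> N \<and> omega_limit b \<subseteq> P)" (is "_ \<longleftrightarrow> ?R")
proof
  assume "\<not> chain_recurrent m f x"
  then show ?R using limit_sets(3,4) gradient_distinct_nodes(1) by metis
next
  assume R: ?R
  show "\<not> chain_recurrent m f x"
  proof
    assume "chain_recurrent m f x"
    then obtain M where M: "M \<in> chain_nodes m f" "x \<in> M" by (rule node_of)
    obtain b where b: "b \<in> bitrajectories_through m f G x" "alpha_limit b \<subseteq> M" "omega_limit b \<subseteq> M"
      using recurrent_bitrajectory[OF assms M] by blast
    obtain N P where NP: "N \<in> chain_nodes m f" "P \<in> chain_nodes m f" "N \<noteq> P"
        "alpha_limit b \<subseteq> N" "omega_limit b \<subseteq> P" using R b(1) by blast
    have "N = M" using limit_sets(1)[OF b(1)] b(2) NP(4) chain_nodes_disjoint[OF NP(1) M(1)] by blast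
    moreover have "P = M" using limit_sets(2)[OF b(1)] b(3) NP(5) chain_nodes_disjoint[OF NP(2) M(1)] by blast
    ultimately show False using NP(3) by simp
  qed
qed

lemma unique_node:
  assumes "S \<noteq> {}" "\<exists>N\<in>chain_nodes m f. S \<subseteq> N"
  shows "\<exists>!N. N \<in> chain_nodes m f \<and> S \<subseteq> N"
  using assms chain_nodes_disjoint[of _ m f] by blast

end

theorem theorem7:
  fixes m :: nat and f :: "nat \<Rightarrow> 'a::metric_space \<Rightarrow> 'a" and G :: "'a set" and x :: 'a
  assumes "separable_space (euclidean :: 'a topology)"
    and "locally_compact_space (euclidean :: 'a topology)"
    and "IFS m f"
    and "global_attractor m f G"
    and "x \<in> G"
  shows
    "let \<B> = bitrajectories_through m f G x;
         orbitwise_recurrent = orbitwise_chain_recurrent m f x;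
         mixed = (chain_recurrent m f x \<and> \<not> orbitwise_chain_recurrent m f x);
         gradient = (\<not> chain_recurrent m f x)
     in
       ((orbitwise_recurrent \<and> \<not> mixed \<and> \<not> gradient) \<or>
        (\<not> orbitwise_recurrent \<and> mixed \<and> \<not> gradient) \<or>
        (\<not> orbitwise_recurrent \<and> \<not> mixed \<and> gradient)) \<and>
       (orbitwise_recurrent \<longleftrightarrow>
         (\<exists>N\<in>chain_nodes m f.
            (\<forall>b\<in>\<B>. omega_limit b \<subseteq> N) \<and> (\<exists>b0\<in>\<B>. alpha_limit b0 \<subseteq> N))) \<and>
       (mixed \<longleftrightarrow>
         (\<exists>N\<in>chain_nodes m f. x \<in> N \<and>
            (\<exists>br\<in>\<B>. \<exists>bg\<in>\<B>. \<exists>P\<in>chain_nodes m f. P \<noteq> N \<and>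
               alpha_limit br \<union> omega_limit br \<subseteq> N \<and>
               alpha_limit bg \<subseteq> N \<and> omega_limit bg \<subseteq> P))) \<and>
       (gradient \<longleftrightarrow>
         (\<forall>b\<in>\<B>. \<exists>N\<in>chain_nodes m f. \<exists>P\<in>chain_nodes m f. N \<noteq> P \<and>
            alpha_limit b \<subseteq> N \<and> omega_limit b \<subseteq> P)) \<and>
       (gradient \<longrightarrow>
         (\<forall>b\<in>\<B>.
            (\<exists>!N. N \<in> chain_nodes m f \<and> alpha_limit b \<subseteq> N) \<and>
            (\<exists>!P. P \<in> chain_nodes m f \<and> omega_limit b \<subseteq> P) \<and>
            (\<forall>N\<in>chain_nodes m f. \<forall>P\<in>chain_nodes m f.
               alpha_limit b \<subseteq> N \<longrightarrow> omega_limit b \<subseteq> P \<longrightarrow>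
               N \<noteq> P \<and> (N, P) \<in> chain_graph_edges m f)))"
proof -
  interpret attractor_ifs m f G
    using assms(2-4) by unfold_locales
  have edges: "(\<exists>!N. N \<in> chain_nodes m f \<and> alpha_limit b \<subseteq> N) \<and>
      (\<exists>!P. P \<in> chain_nodes m f \<and> omega_limit b \<subseteq> P) \<and>
      (\<forall>N\<in>chain_nodes m f. \<forall>P\<in>chain_nodes m f.
         alpha_limit b \<subseteq> N \<longrightarrow> omega_limit b \<subseteq> P \<longrightarrow> N \<noteq> P \<and> (N, P) \<in> chain_graph_edges m f)"
    if "\<not> chain_recurrent m f x" "b \<in> bitrajectories_through m f G x" for b
  proof (intro conjI ballI impI)
    show "\<exists>!N. N \<in> chain_nodes m f \<and> alpha_limit b \<subseteq> N"
      by (rule unique_node[OF limit_sets(1,3)[OF that(2)]])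
    show "\<exists>!P. P \<in> chain_nodes m f \<and> omega_limit b \<subseteq> P"
      by (rule unique_node[OF limit_sets(2,4)[OF that(2)]])
  qed (rule gradient_distinct_nodes[OF that]; assumption)+
  have grad: "\<not> chain_recurrent m f x \<longrightarrow>
      (\<forall>b\<in>bitrajectories_through m f G x.
        (\<exists>!N. N \<in> chain_nodes m f \<and> alpha_limit b \<subseteq> N) \<and>
        (\<exists>!P. P \<in> chain_nodes m f \<and> omega_limit b \<subseteq> P) \<and>
        (\<forall>N\<in>chain_nodes m f. \<forall>P\<in>chain_nodes m f.
          alpha_limit b \<subseteq> N \<longrightarrow> omega_limit b \<subseteq> P \<longrightarrow>
          N \<noteq> P \<and> (N, P) \<in> chain_graph_edges m f))"
    by (intro impI ballI edges)
  show ?thesis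
    unfolding Let_def
  proof (intro conjI orbitwise_iff mixed_iff gradient_iff grad assms(5))
  \<comment> \<open>What remains is the propositional trichotomy, which rests on orbitwise
    chain-recurrence implying chain-recurrence.\<close>
  qed (use orbitwise_imp_recurrent[of x] in argo)
qed

end
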